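(* Let $B_1,\dots,B_D$ be resonator blocks, let $\chi\in\{1,\dots,D\}^{\mathbb{Z}}$ be a pseudo-ergodic block sequence, and let $\mathcal{J}(\chi)$ be the associated Jacobi operator on $\ell^2(\mathbb{Z})$. Let $\lambda\ge0$. (i) If $|\mathrm{tr}\,\mathcal{P}^\lambda_d|>2$ for all $d=1,\dots,D$ and the family $\{\mathcal{P}^\lambda_1,\dots,\mathcal{P}^\lambda_D\}$ satisfies the source-sink condition, then $\lambda\notin\sigma(\mathcal{J}(\chi))$. (ii) If $|\mathrm{tr}\,\mathcal{P}^\lambda_d|\le2$ for some $d\in\{1,\dots,D\}$, then $\lambda\in\sigma(\mathcal{J}(\chi))$.
   Context: A resonator block $B_d$ is a finite sequence of $\mathrm{len}(B_d)\ge1$ triples $(v_k(B_d),\ell_k(B_d),s_k(B_d))$ of positive reals (wave speed, length, spacing). The resonator sequence $(v_i,\ell_i,s_i)_{i\in\mathbb{Z}}$ of $\chi$ is obtained by concatenating $B_{\chi(j)}$, $j\in\mathbb{Z}$, in order, with the first resonator of $B_{\chi(0)}$ at index $0$. The Jacobi operator is $(\mathcal{J}(\chi)\mathbf{v})^{(i)}=a^{(i-1)}\mathbf{v}^{(i-1)}+a^{(i)}\mathbf{v}^{(i+1)}+b^{(i)}\mathbf{v}^{(i)}$ with $a^{(i)}=-\frac{v_iv_{i+1}}{s_i\sqrt{\ell_i\ell_{i+1}}}$, $b^{(i)}=\frac{v_i^2}{\ell_i}\big(\frac1{s_{i-1}}+\frac1{s_i}\big)$. $\chi$ is pseudo-ergodic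 if every finite word in $\{1,\dots,D\}^M$, $M\in\mathbb{N}$, occurs as a consecutive subword of $\chi$. For $\ell,s,v>0$ let $P^\lambda_{\ell,s,v}=\begin{pmatrix}1-s\frac{\ell}{v^2}\lambda & s\\ -\frac{\ell}{v^2}\lambda & 1\end{pmatrix}$; the block propagation matrix is $\mathcal{P}^\lambda_d=P^\lambda_{\ell_L,s_L,v_L}\cdots P^\lambda_{\ell_1,s_1,v_1}$ with $L=\mathrm{len}(B_d)$ and $(v_k,\ell_k,s_k)$ the parameters of $B_d$. For hyperbolic $A\in\mathrm{SL}(2,\mathbb{R})$ (i.e. $|\mathrm{tr}A|>2$) with eigenvalues $|\xi_1|<1<|\xi_2|$ and eigenlines $E_1,E_2$, its source is $s(A)=E_1$ and its sink $u(A)=E_2$, viewed as points of $\mathbb{RP}^1$. A family of hyperbolic $\{A_1,\dots,A_D\}$ satisfies the source-sink condition if all sinks $u(A_d)$ lie in the same connected component of $\mathbb{RP}^1\setminus\{s(A_1),\dots,s(A_D)\}$. *)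

theory Defs
  imports "HOL-Analysis.Analysis"
begin

text \<open>A resonator is a triple (v, l, s): wave speed, length, spacing.
  A block is a list of resonators; the family of blocks is B :: nat => block,
  with blocks indexed by d in {1..D}. A block sequence is chi :: int => nat.\<close>

type_synonym resonator = "real \<times> real \<times> real"

definition res_v :: "resonator \<Rightarrow> real" where "res_v r = fst r"
definition res_l :: "resonator \<Rightarrow> real" where "res_l r = fst (snd r)"
definition res_s :: "resonator \<Rightarrow> real" where "res_s r = snd (snd r)"

definition valid_blocks :: "nat \<Rightarrow> (nat \<Rightarrow> resonator list) \<Rightarrow> bool" where
  "valid_blocks D B \<longleftrightarrow> D \<ge> 1 \<and> (\<forall>d\<in>{1..D}. B d \<noteq> [] \<and>
     (\<forall>r\<in>set (B d). res_v r > 0 \<and> res_l r > 0 \<and> res_s r > 0))"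

definition block_start :: "(nat \<Rightarrow> resonator list) \<Rightarrow> (int \<Rightarrow> nat) \<Rightarrow> int \<Rightarrow> int" where
  "block_start B chi j =
     (if j \<ge> 0 then (\<Sum>k\<in>{0..<j}. int (length (B (chi k))))
      else - (\<Sum>k\<in>{j..<0}. int (length (B (chi k)))))"

definition res_seq :: "(nat \<Rightarrow> resonator list) \<Rightarrow> (int \<Rightarrow> nat) \<Rightarrow> int \<Rightarrow> resonator" where
  "res_seq B chi i =
     (let j = (THE j. block_start B chi j \<le> i \<and> i < block_start B chi (j + 1))
      in B (chi j) ! nat (i - block_start B chi j))"

definition pseudo_ergodic :: "nat \<Rightarrow> (int \<Rightarrow> nat) \<Rightarrow> bool" where
  "pseudo_ergodic D chi \<longleftrightarrow>
     (\<forall>w::nat list. w \<noteq> [] \<longrightarrow> set w \<subseteq> {1..D} \<longrightarrow>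
        (\<exists>n::int. \<forall>k<length w. chi (n + int k) = w ! k))"

definition jac_a :: "(nat \<Rightarrow> resonator list) \<Rightarrow> (int \<Rightarrow> nat) \<Rightarrow> int \<Rightarrow> real" where
  "jac_a B chi i =
     (let r = res_seq B chi i; r' = res_seq B chi (i + 1) in
      - (res_v r * res_v r') / (res_s r * sqrt (res_l r * res_l r')))"

definition jac_b :: "(nat \<Rightarrow> resonator list) \<Rightarrow> (int \<Rightarrow> nat) \<Rightarrow> int \<Rightarrow> real" where
  "jac_b B chi i =
     (let r = res_seq B chi i; rm = res_seq B chi (i - 1) in
      (res_v r)\<^sup>2 / res_l r * (1 / res_s rm + 1 / res_s r))"

definition jacobi :: "(nat \<Rightarrow> resonator list) \<Rightarrow> (int \<Rightarrow> nat) \<Rightarrow> (int \<Rightarrow> complex) \<Rightarrow> int \<Rightarrow> complex" where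
  "jacobi B chi u i =
     of_real (jac_a B chi (i - 1)) * u (i - 1) + of_real (jac_a B chi i) * u (i + 1)
     + of_real (jac_b B chi i) * u i"

definition l2 :: "(int \<Rightarrow> complex) set" where
  "l2 = {u. (\<lambda>i. (cmod (u i))\<^sup>2) summable_on UNIV}"

definition l2_norm :: "(int \<Rightarrow> complex) \<Rightarrow> real" where
  "l2_norm u = sqrt (infsum (\<lambda>i. (cmod (u i))\<^sup>2) UNIV)"

definition in_spectrum :: "((int \<Rightarrow> complex) \<Rightarrow> int \<Rightarrow> complex) \<Rightarrow> complex \<Rightarrow> bool" where
  "in_spectrum T mu \<longleftrightarrow>
     \<not> (bij_betw (\<lambda>u i. T u i - mu * u i) l2 l2 \<and>
        (\<exists>C. \<forall>u\<in>l2. l2_norm u \<le> C * l2_norm (\<lambda>i. T u i - mu * u i)))"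

definition prop_mat :: "real \<Rightarrow> resonator \<Rightarrow> real^2^2" where
  "prop_mat lam r =
     (let v = res_v r; l = res_l r; s = res_s r in
      vector [vector [1 - s * l / v\<^sup>2 * lam, s], vector [- l / v\<^sup>2 * lam, 1]])"

definition block_prop :: "real \<Rightarrow> resonator list \<Rightarrow> real^2^2" where
  "block_prop lam rs = foldl (\<lambda>M r. prop_mat lam r ** M) (mat 1) rs"

text \<open>RP^1 is identified with the unit circle via the homeomorphism sending the
  line spanned by (x,y) (nonzero) to (x + i y)^2 / |x + i y|^2.\<close>
definition rp1 :: "real^2 \<Rightarrow> complex" where
  "rp1 w = (Complex (w$1) (w$2))\<^sup>2 / of_real ((cmod (Complex (w$1) (w$2)))\<^sup>2)"

definition source :: "real^2^2 \<Rightarrow> complex" where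
  "source A = (SOME p. \<exists>w \<xi>. w \<noteq> 0 \<and> A *v w = \<xi> *\<^sub>R w \<and> \<bar>\<xi>\<bar> < 1 \<and> p = rp1 w)"

definition sink :: "real^2^2 \<Rightarrow> complex" where
  "sink A = (SOME p. \<exists>w \<xi>. w \<noteq> 0 \<and> A *v w = \<xi> *\<^sub>R w \<and> \<bar>\<xi>\<bar> > 1 \<and> p = rp1 w)"

definition source_sink :: "nat set \<Rightarrow> (nat \<Rightarrow> real^2^2) \<Rightarrow> bool" where
  "source_sink I A \<longleftrightarrow>
     (\<forall>d\<in>I. \<forall>d'\<in>I.
        connected_component (sphere 0 1 - (\<lambda>e. source (A e)) ` I) (sink (A d)) (sink (A d')))"

end

theory Submission
  imports Defs
begin

text \<open>With \<open>x\<^sub>i = v\<^sub>i u\<^sub>i / sqrt l\<^sub>i\<close> and \<open>y\<^sub>i = (x\<^sub>i - x\<^sub>i\<^sub>-\<^sub>1) / s\<^sub>i\<^sub>-\<^sub>1\<close>, the equation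
  \<open>(J - \<lambda>) u = f\<close> becomes \<open>z\<^sub>i\<^sub>+\<^sub>1 = P\<^sub>i z\<^sub>i - h\<^sub>i\<close> with \<open>h\<^sub>i\<close> proportional to \<open>f\<^sub>i\<close>.

  (i) The double angle turns quadratic forms on the plane into affine functions on the circle.
  The source-sink condition says that a line separates the sinks from the sources, so there is a
  form \<open>Q\<close>, positive on all sinks and negative on all sources. As the block matrices have
  determinant 1, \<open>Q\<close> strictly increases under each of them, and by interpolation one gets forms
  \<open>Q\<^sub>i\<close> that increase, uniformly, at every site. Telescoping \<open>Q\<^sub>i\<^sub>+\<^sub>1(z\<^sub>i\<^sub>+\<^sub>1) - Q\<^sub>i(z\<^sub>i)\<close> bounds \<open>z\<close> by \<open>h\<close>
  in the square-summable norm. Solutions are limits of solutions on finite windows whose boundary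
  values make the telescoped terms have the good sign.

  (ii) A block matrix with \<open>\<bar>tr\<bar> \<le> 2\<close> has a complex eigenvalue of modulus 1. Its Bloch wave, cut off
  to a long run of copies of the block, has large norm and bounded residual.\<close>

section \<open>Separating sinks from sources by a quadratic form\<close>

text \<open>Together with the mirrored version this picks the end points of an interval that
  strictly contains the coordinates of all sinks and keeps a distance from those of the
  sources.\<close>

lemma finite_gap_below:
  fixes t :: real
  assumes "finite F"
  obtains a where "a < t" "\<And>f. f \<in> F \<Longrightarrow> f < t \<Longrightarrow> f < a"
proof -
  \<comment> \<open>The extra element \<open>t - 1\<close> keeps the maximum defined when no element
    of \<open>F\<close> lies below \<open>t\<close>.\<close>
  have fin: "finite (insert (t - 1) {f \<in> F. f < t})" using assms by simp
  have "Max (insert (t - 1) {f \<in> F. f < t}) \<in> insert (t - 1) {f \<in> F. f < t}"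
    using fin by (intro Max_in) auto
  then have "Max (insert (t - 1) {f \<in> F. f < t}) < t" by auto
  then obtain a where a: "Max (insert (t - 1) {f \<in> F. f < t}) < a" "a < t"
    using dense by blast
  show thesis
  proof (rule that[of a])
    fix f assume "f \<in> F" "f < t"
    then have "f \<le> Max (insert (t - 1) {f \<in> F. f < t})" using fin by (intro Max_ge) auto
    then show "f < a" using a by linarith
  qed (use a in auto)
qed

lemma finite_gap_above:
  fixes t :: real
  assumes "finite F"
  obtains a where "t < a" "\<And>f. f \<in> F \<Longrightarrow> t < f \<Longrightarrow> a < f"
proof -
  obtain a where a: "a < - t" "\<And>f. f \<in> uminus ` F \<Longrightarrow> f < - t \<Longrightarrow> f < a"
    using finite_gap_below[of "uminus ` F" "- t"] assms by blast
  show thesis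
    by (rule that[of "- a"]) (use a in force)+
qed

section \<open>Stereographic projection of the unit circle\<close>

lemma unit_circle_eq: "p \<in> sphere 0 1 \<longleftrightarrow> (Re p)\<^sup>2 + (Im p)\<^sup>2 = 1" for p :: complex
  by (simp add: norm_complex_def)

lemma unit_circle_Re_less_1:
  assumes "p \<in> sphere 0 1" "p \<noteq> 1"
  shows "Re p < 1"
proof -
  have eq: "(Re p)\<^sup>2 + (Im p)\<^sup>2 = 1" using assms unit_circle_eq by blast
  have "Re p \<le> 1" using complex_Re_le_cmod[of p] assms by simp
  moreover have "Re p \<noteq> 1"
  proof
    assume "Re p = 1"
    with eq have "Im p = 0" by simp
    with \<open>Re p = 1\<close> show False using assms by (simp add: complex_eq_iff)
  qed
  ultimately show ?thesis by simp
qed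

text \<open>The coordinate \<open>t\<close> determines the point:
  \<open>1 - Re r = 2 / (t^2 + 1)\<close> on the circle, and then
  \<open>Im r = t * (1 - Re r)\<close>.\<close>

lemma stereographic_inj_on: "inj_on (\<lambda>p. Im p / (1 - Re p)) (sphere 0 1 - {1})"
proof (rule inj_onI)
  fix p q :: complex
  assume p: "p \<in> sphere 0 1 - {1}" and q: "q \<in> sphere 0 1 - {1}"
    and eq: "Im p / (1 - Re p) = Im q / (1 - Re q)"
  have key: "(1 - Re r) * ((Im r / (1 - Re r))\<^sup>2 + 1) = 2"
    if "r \<in> sphere 0 1 - {1}" for r :: complex
  proof -
    have "1 - Re r \<noteq> 0" using unit_circle_Re_less_1[of r] that by auto
    moreover have "(Im r)\<^sup>2 = (1 - Re r) * (1 + Re r)"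
      using unit_circle_eq[of r] that by (simp add: power2_eq_square algebra_simps)
    ultimately have "(1 - Re r) * (Im r / (1 - Re r))\<^sup>2 = 1 + Re r"
      by (simp add: power_divide) (simp add: power2_eq_square)
    then show ?thesis by (simp add: distrib_left)
  qed
  let ?t = "Im p / (1 - Re p)"
  have "?t\<^sup>2 + 1 \<noteq> 0" by (smt (verit) zero_le_power2)
  then have "Re p = Re q" using key[OF p] key[OF q] eq by (metis diff_left_imp_eq mult_right_cancel diff_eq_eq)
  moreover have "Im p = Im q"
    using eq calculation unit_circle_Re_less_1[of p] p by auto
  ultimately show "p = q" by (simp add: complex_eq_iff)
qed

text \<open>In the stereographic coordinate \<open>t\<close> from the point 1, the quadratic polynomial
  \<open>(b - t) (t - a)\<close> becomes affine after multiplication by \<open>1 - Re p\<close>.\<close>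

lemma arc_separation_from_1:
  fixes U S T :: "complex set"
  assumes fin: "finite U" "finite S" and S: "1 \<in> S" "S \<subseteq> sphere 0 1"
    and T: "connected T" "U \<subseteq> T" "T \<subseteq> sphere 0 1 - S"
  shows "\<exists>\<alpha> \<beta> \<gamma>::real. (\<forall>p\<in>U. 0 < \<alpha> + \<beta> * Re p + \<gamma> * Im p) \<and>
    (\<forall>p\<in>S. \<alpha> + \<beta> * Re p + \<gamma> * Im p < 0)"
proof (cases "U = {}")
  case True
  then show ?thesis by (intro exI[of _ "-1"] exI[of _ 0]) auto
next
  case False
  define t where "t p = Im p / (1 - Re p)" for p :: complex
  have T1: "T \<subseteq> sphere 0 1 - {1}" using T S by auto
  have "continuous_on T t" unfolding t_def
    using T1 unit_circle_Re_less_1 by (intro continuous_intros) fastforce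
  then have conn: "connected (t ` T)" using T(1) connected_continuous_image by blast
  define t1 t2 where "t1 = Min (t ` U)" and "t2 = Max (t ` U)"
  have t12: "t1 \<in> t ` T" "t2 \<in> t ` T"
    using False fin T(2) Min_in[of "t ` U"] Max_in[of "t ` U"] unfolding t1_def t2_def by blast+
  have tU: "t1 \<le> t p" "t p \<le> t2" if "p \<in> U" for p
    using that fin unfolding t1_def t2_def by auto
  let ?F = "t ` (S - {1})"
  \<comment> \<open>The image of the connected set \<open>T\<close> is an interval containing
    \<open>t1\<close> and \<open>t2\<close>. A source coordinate between them would, by injectivity,
    put that source into \<open>T\<close>.\<close>
  have disj: "\<not> (t1 \<le> f \<and> f \<le> t2)" if "f \<in> ?F" for f
  proof
    assume "t1 \<le> f \<and> f \<le> t2"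
    then have "f \<in> t ` T" using conn t12 by (meson connected_iff_interval)
    then obtain p where "p \<in> T" "t p = f" by (metis imageE)
    moreover obtain s where "s \<in> S - {1}" "t s = f" using \<open>f \<in> ?F\<close> by (metis imageE)
    ultimately have "p = s"
      using stereographic_inj_on T1 S(2) unfolding t_def inj_on_def by blast
    then show False using \<open>p \<in> T\<close> \<open>s \<in> S - {1}\<close> T(3) by auto
  qed
  have finF: "finite ?F" using fin by simp
  obtain a where a: "a < t1" "\<And>f. f \<in> ?F \<Longrightarrow> f < t1 \<Longrightarrow> f < a"
    using finite_gap_below[OF finF] by metis
  obtain b where b: "t2 < b" "\<And>f. f \<in> ?F \<Longrightarrow> t2 < f \<Longrightarrow> b < f"
    using finite_gap_above[OF finF] by metis
  have "a < b" using a(1) b(1) tU False by (meson ex_in_conv le_less_trans less_trans less_le_trans)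
  \<comment> \<open>These coefficients come from expanding
    \<open>(1 - Re p) * (b - t) * (t - a)\<close> with \<open>t * (1 - Re p) = Im p\<close> and
    \<open>t^2 * (1 - Re p) = 1 + Re p\<close>.\<close>
  define L where "L p = (- 1 - a * b) + (a * b - 1) * Re p + (a + b) * Im p" for p
  have L: "L p = (1 - Re p) * ((b - t p) * (t p - a))" and pos: "1 - Re p > 0"
    if "p \<in> sphere 0 1" "p \<noteq> 1" for p
  proof -
    show pos: "1 - Re p > 0" using unit_circle_Re_less_1 that by fastforce
    have i: "Im p = t p * (1 - Re p)" using pos unfolding t_def by simp
    have "(1 - Re p) * ((t p)\<^sup>2 * (1 - Re p)) = (1 - Re p) * (1 + Re p)"
      using unit_circle_eq[of p] that unfolding i by (simp add: power2_eq_square algebra_simps)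
    then have "(t p)\<^sup>2 * (1 - Re p) = 1 + Re p" using pos by simp
    then show "L p = (1 - Re p) * ((b - t p) * (t p - a))"
      unfolding L_def i by (simp add: power2_eq_square algebra_simps)
  qed
  have "0 < L p" if "p \<in> U" for p
  proof -
    have "p \<in> sphere 0 1" "p \<noteq> 1" using that T S by auto
    moreover have "(b - t p) * (t p - a) > 0"
      using tU[OF that] a(1) b(1) by (intro mult_pos_pos) linarith+
    ultimately show ?thesis using L pos by (metis mult_pos_pos)
  qed
  moreover have "L p < 0" if "p \<in> S" for p
  proof (cases "p = 1")
    case True
    \<comment> \<open>At the centre of projection, which has no coordinate, the affine function
      takes the value -2.\<close>
    then show ?thesis by (simp add: L_def)
  next
    case False
    then have f: "t p \<in> ?F" using that by auto
    have "t p < a \<or> b < t p" using disj[OF f] a(2)[OF f] b(2)[OF f] by linarith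
    then have "(b - t p) * (t p - a) < 0"
      using \<open>a < b\<close> by (auto simp: mult_less_0_iff)
    then show ?thesis using L[of p] pos[of p] that False S by (metis mult_pos_neg subsetD)
  qed
  ultimately show ?thesis unfolding L_def by blast
qed

text \<open>A rotation moves some point \<open>s\<close> of \<open>S\<close> to 1, and an affine
  function composed with a rotation is again affine.\<close>

lemma arc_separation:
  fixes U S T :: "complex set"
  assumes fin: "finite U" "finite S" and S: "S \<noteq> {}" "S \<subseteq> sphere 0 1"
    and T: "connected T" "U \<subseteq> T" "T \<subseteq> sphere 0 1 - S"
  shows "\<exists>\<alpha> \<beta> \<gamma>::real. (\<forall>p\<in>U. 0 < \<alpha> + \<beta> * Re p + \<gamma> * Im p) \<and>
    (\<forall>p\<in>S. \<alpha> + \<beta> * Re p + \<gamma> * Im p < 0)"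
proof -
  obtain s where s: "s \<in> S" using S by auto
  then have ns: "cmod s = 1" using S by auto
  then have s1: "s * cnj s = 1" by (simp add: complex_norm_square[symmetric])
  let ?r = "\<lambda>p. p * cnj s"
  have inj: "inj ?r" using s1 by (intro injI) auto
  have "\<exists>\<alpha> \<beta> \<gamma>::real. (\<forall>p\<in>?r ` U. 0 < \<alpha> + \<beta> * Re p + \<gamma> * Im p) \<and>
    (\<forall>p\<in>?r ` S. \<alpha> + \<beta> * Re p + \<gamma> * Im p < 0)"
  proof (rule arc_separation_from_1)
    show "1 \<in> ?r ` S" using s s1 by force
    show "?r ` S \<subseteq> sphere 0 1" using S ns by (auto simp: norm_mult)
    show "connected (?r ` T)"
      by (intro connected_continuous_image continuous_intros T(1))
    have "?r ` T \<inter> ?r ` S = {}" using T(3) inj_onD[OF inj] by blast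
    then show "?r ` T \<subseteq> sphere 0 1 - ?r ` S" using T(3) ns by (auto simp: norm_mult)
  qed (use fin T in auto)
  then obtain \<alpha> \<beta> \<gamma> :: real
    where "\<forall>p\<in>U. 0 < \<alpha> + \<beta> * Re (?r p) + \<gamma> * Im (?r p)"
      "\<forall>p\<in>S. \<alpha> + \<beta> * Re (?r p) + \<gamma> * Im (?r p) < 0" by auto
  \<comment> \<open>The new coefficients are those of the affine function composed with
    multiplication by \<open>cnj s\<close>.\<close>
  then show ?thesis
    by (intro exI[of _ \<alpha>] exI[of _ "\<beta> * Re s - \<gamma> * Im s"] exI[of _ "\<beta> * Im s + \<gamma> * Re s"])
      (simp add: algebra_simps)
qed

section \<open>Quadratic forms and eigenlines of hyperbolic matrices\<close>

definition qform :: "real^2^2 \<Rightarrow> real^2 \<Rightarrow> real" where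
  "qform S z = z \<bullet> (S *v z)"

lemma qform_2: "qform S z = S$1$1 * (z$1)\<^sup>2 + (S$1$2 + S$2$1) * (z$1 * z$2) + S$2$2 * (z$2)\<^sup>2"
  unfolding qform_def
  by (simp add: inner_vec_def matrix_vector_mult_def sum_2 power2_eq_square algebra_simps)

lemma norm_2: "(norm z)\<^sup>2 = (z$1)\<^sup>2 + (z$2)\<^sup>2" for z :: "real^2"
  by (simp add: norm_eq_sqrt_inner inner_vec_def sum_2 power2_eq_square)

text \<open>Quadratic forms on the plane are exactly the affine functions of the double angle.\<close>

lemma qform_rp1:
  assumes "z \<noteq> 0"
  shows "qform (vector [vector [\<alpha> + \<beta>, \<gamma>], vector [\<gamma>, \<alpha> - \<beta>]]) z =
    (norm z)\<^sup>2 * (\<alpha> + \<beta> * Re (rp1 z) + \<gamma> * Im (rp1 z))"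
proof -
  have n: "(cmod (Complex (z$1) (z$2)))\<^sup>2 = (norm z)\<^sup>2"
    by (simp add: cmod_power2 norm_2)
  have "(norm z)\<^sup>2 \<noteq> 0" using assms by simp
  then have "(norm z)\<^sup>2 * Re (rp1 z) = (z$1)\<^sup>2 - (z$2)\<^sup>2" "(norm z)\<^sup>2 * Im (rp1 z) = 2 * z$1 * z$2"
    unfolding rp1_def n by (simp_all add: Re_divide_of_real Im_divide_of_real Re_power2 Im_power2)
  moreover have "(norm z)\<^sup>2 * (\<alpha> + \<beta> * Re (rp1 z) + \<gamma> * Im (rp1 z)) =
    \<alpha> * (norm z)\<^sup>2 + \<beta> * ((norm z)\<^sup>2 * Re (rp1 z)) + \<gamma> * ((norm z)\<^sup>2 * Im (rp1 z))"
    by (simp add: algebra_simps)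
  ultimately have "(norm z)\<^sup>2 * (\<alpha> + \<beta> * Re (rp1 z) + \<gamma> * Im (rp1 z)) =
    \<alpha> * ((z$1)\<^sup>2 + (z$2)\<^sup>2) + \<beta> * ((z$1)\<^sup>2 - (z$2)\<^sup>2) + \<gamma> * (2 * z$1 * z$2)"
    by (simp only: norm_2)
  then show ?thesis by (simp add: qform_2 algebra_simps)
qed

lemma rp1_in_sphere:
  assumes "z \<noteq> 0"
  shows "rp1 z \<in> sphere 0 1"
proof -
  have "Complex (z$1) (z$2) \<noteq> 0" using assms by (auto simp: complex_eq_iff vec_eq_iff forall_2)
  then show ?thesis by (simp add: rp1_def norm_divide norm_power)
qed

lemma parallel_2:
  fixes w x :: "real^2"
  assumes "w \<noteq> 0" "w$1 * x$2 - w$2 * x$1 = 0"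
  obtains k where "x = k *\<^sub>R w"
proof (cases "w$1 = 0")
  case True
  then have "w$2 \<noteq> 0" using assms(1) by (auto simp: vec_eq_iff forall_2)
  then show thesis using that[of "x$2 / w$2"] assms(2) True
    by (auto simp: vec_eq_iff forall_2 field_simps)
next
  case False
  then show thesis using that[of "x$1 / w$1"] assms(2)
    by (auto simp: vec_eq_iff forall_2 field_simps)
qed

lemma eigenvector_2:
  fixes A :: "real^2^2"
  assumes "\<xi>\<^sup>2 - trace A * \<xi> + det A = 0"
  shows "\<exists>w. w \<noteq> 0 \<and> A *v w = \<xi> *\<^sub>R w"
proof -
  have "det (A - mat \<xi>) = 0"
    using assms by (simp add: det_2 trace_def sum_2 mat_def power2_eq_square algebra_simps)
  then have "\<not> invertible (A - mat \<xi>)" by (simp add: invertible_det_nz)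
  then obtain w where "w \<noteq> 0" "(A - mat \<xi>) *v w = 0"
    by (meson invertible_left_inverse matrix_left_invertible_ker)
  moreover have "mat \<xi> *v w = \<xi> *\<^sub>R w"
    by (simp add: vec_eq_iff forall_2 matrix_vector_mult_def sum_2 mat_def)
  ultimately show ?thesis by (intro exI[of _ w]) (simp add: matrix_vector_mult_diff_rdistrib)
qed

text \<open>The roots have product 1. The one in which the square root carries the sign of \<tau>
  has modulus above 1, and the other is its inverse.\<close>

lemma hyperbolic_eigenvalues:
  fixes \<tau> :: real
  assumes "\<bar>\<tau>\<bar> > 2"
  obtains \<xi> \<eta> where "\<bar>\<xi>\<bar> > 1" "\<bar>\<eta>\<bar> < 1" "\<xi>\<^sup>2 - \<tau> * \<xi> + 1 = 0" "\<eta>\<^sup>2 - \<tau> * \<eta> + 1 = 0"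
proof -
  define r where "r = sqrt (\<tau>\<^sup>2 - 4)"
  have "\<tau>\<^sup>2 > 2\<^sup>2" using assms by (metis abs_numeral abs_le_square_iff not_le)
  then have r: "r\<^sup>2 = \<tau>\<^sup>2 - 4" "r > 0" unfolding r_def by auto
  define \<xi> where "\<xi> = (\<tau> + sgn \<tau> * r) / 2"
  have "\<bar>\<xi>\<bar> > 1" unfolding \<xi>_def using assms r(2) by (auto simp: sgn_if abs_if)
  have eq: "\<xi>\<^sup>2 - \<tau> * \<xi> + 1 = 0"
  proof -
    have "(sgn \<tau> * r)\<^sup>2 = \<tau>\<^sup>2 - 4" using assms r(1) by (auto simp: sgn_if)
    then show ?thesis unfolding \<xi>_def by (simp add: power2_eq_square field_simps)
  qed
  have "\<xi> \<noteq> 0" using \<open>\<bar>\<xi>\<bar> > 1\<close> by auto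
  have "(inverse \<xi>)\<^sup>2 - \<tau> * inverse \<xi> + 1 = (inverse \<xi>)\<^sup>2 * (\<xi>\<^sup>2 - \<tau> * \<xi> + 1)"
    using \<open>\<xi> \<noteq> 0\<close> by (simp add: field_simps power2_eq_square)
  moreover have "\<bar>inverse \<xi>\<bar> < 1" using \<open>\<bar>\<xi>\<bar> > 1\<close> by (simp add: abs_inverse inverse_less_1_iff)
  ultimately show thesis using that[of \<xi> "inverse \<xi>"] \<open>\<bar>\<xi>\<bar> > 1\<close> eq by simp
qed

text \<open>An expanding eigenvector exists, so the choice operator in \<open>sink\<close> does
  return the direction of one.\<close>

lemma sink_eigenvector:
  assumes "det A = 1" "\<bar>trace A\<bar> > 2"
  obtains w \<xi> where "w \<noteq> 0" "A *v w = \<xi> *\<^sub>R w" "\<bar>\<xi>\<bar> > 1" "sink A = rp1 w"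
proof -
  obtain \<xi> where \<xi>: "\<bar>\<xi>\<bar> > 1" "\<xi>\<^sup>2 - trace A * \<xi> + det A = 0"
    using hyperbolic_eigenvalues[OF assms(2)] assms(1) by metis
  obtain w where "w \<noteq> 0" "A *v w = \<xi> *\<^sub>R w" using eigenvector_2[OF \<xi>(2)] by auto
  then have "\<exists>p w \<xi>. w \<noteq> 0 \<and> A *v w = \<xi> *\<^sub>R w \<and> \<bar>\<xi>\<bar> > 1 \<and> p = rp1 w" using \<xi> by blast
  from someI_ex[OF this] show thesis using that unfolding sink_def by blast
qed

lemma source_eigenvector:
  assumes "det A = 1" "\<bar>trace A\<bar> > 2"
  obtains w \<xi> where "w \<noteq> 0" "A *v w = \<xi> *\<^sub>R w" "\<bar>\<xi>\<bar> < 1" "source A = rp1 w"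
proof -
  obtain \<xi> where \<xi>: "\<bar>\<xi>\<bar> < 1" "\<xi>\<^sup>2 - trace A * \<xi> + det A = 0"
    using hyperbolic_eigenvalues[OF assms(2)] assms(1) by metis
  obtain w where "w \<noteq> 0" "A *v w = \<xi> *\<^sub>R w" using eigenvector_2[OF \<xi>(2)] by auto
  then have "\<exists>p w \<xi>. w \<noteq> 0 \<and> A *v w = \<xi> *\<^sub>R w \<and> \<bar>\<xi>\<bar> < 1 \<and> p = rp1 w" using \<xi> by blast
  from someI_ex[OF this] show thesis using that unfolding source_def by blast
qed

lemma qform_scaleR: "qform S (c *\<^sub>R z) = c\<^sup>2 * qform S z"
  by (simp add: qform_def matrix_vector_mult_scaleR power2_eq_square)

text \<open>The eigenvalues are reciprocal, so the mixed term of the form in the eigenbasis is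
  unchanged by the matrix.\<close>

lemma qform_increasing:
  fixes A :: "real^2^2"
  assumes det: "det A = 1" and w: "w \<noteq> 0" "A *v w = \<xi> *\<^sub>R w" "\<bar>\<xi>\<bar> > 1" "qform S w > 0"
    and x: "x \<noteq> 0" "A *v x = \<eta> *\<^sub>R x" "\<bar>\<eta>\<bar> < 1" "qform S x < 0"
    and z: "z \<noteq> 0"
  shows "qform S z < qform S (A *v z)"
proof -
  define \<delta> where "\<delta> = w$1 * x$2 - w$2 * x$1"
  have Aw: "A$1$1 * w$1 + A$1$2 * w$2 = \<xi> * w$1" "A$2$1 * w$1 + A$2$2 * w$2 = \<xi> * w$2"
    using w(2) by (auto simp: vec_eq_iff forall_2 matrix_vector_mult_def sum_2)
  have Ax: "A$1$1 * x$1 + A$1$2 * x$2 = \<eta> * x$1" "A$2$1 * x$1 + A$2$2 * x$2 = \<eta> * x$2"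
    using x(2) by (auto simp: vec_eq_iff forall_2 matrix_vector_mult_def sum_2)
  \<comment> \<open>The form has opposite signs on \<open>w\<close> and \<open>x\<close>, so neither
    is a multiple of the other.\<close>
  have "\<delta> \<noteq> 0"
  proof
    assume "\<delta> = 0"
    then obtain k where k: "x = k *\<^sub>R w" using parallel_2[OF w(1)] unfolding \<delta>_def by blast
    then have "qform S x = k\<^sup>2 * qform S w" by (simp add: qform_scaleR)
    then show False using w(4) x(4) by (smt (verit) mult_nonneg_nonneg zero_le_power2)
  qed
  \<comment> \<open>Comparing the area spanned by the images of \<open>w\<close> and
    \<open>x\<close> with the original area shows that the product of the eigenvalues is the
    determinant.\<close>
  have "(\<xi> * \<eta>) * \<delta> = (\<xi> * w$1) * (\<eta> * x$2) - (\<xi> * w$2) * (\<eta> * x$1)"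
    by (simp add: \<delta>_def algebra_simps)
  also have "\<dots> = det A * \<delta>"
    unfolding Aw[symmetric] Ax[symmetric] by (simp add: \<delta>_def det_2 algebra_simps)
  finally have \<xi>\<eta>: "\<xi> * \<eta> = 1" using \<open>\<delta> \<noteq> 0\<close> det by simp
  \<comment> \<open>Coordinates of \<open>z\<close> in the eigenbasis, by Cramer's rule.\<close>
  define a b where "a = (z$1 * x$2 - z$2 * x$1) / \<delta>" and "b = (w$1 * z$2 - w$2 * z$1) / \<delta>"
  have zab: "z = a *\<^sub>R w + b *\<^sub>R x"
  proof -
    have "\<delta> * z$1 = (z$1 * x$2 - z$2 * x$1) * w$1 + (w$1 * z$2 - w$2 * z$1) * x$1"
      "\<delta> * z$2 = (z$1 * x$2 - z$2 * x$1) * w$2 + (w$1 * z$2 - w$2 * z$1) * x$2"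
      by (simp_all add: \<delta>_def algebra_simps)
    then have "z$1 = a * w$1 + b * x$1" "z$2 = a * w$2 + b * x$2"
      unfolding a_def b_def times_divide_eq_left add_divide_distrib[symmetric]
      using \<open>\<delta> \<noteq> 0\<close> by (metis nonzero_mult_div_cancel_left)+
    then show ?thesis by (simp add: vec_eq_iff forall_2)
  qed
  have comb: "qform S (p *\<^sub>R w + q *\<^sub>R x) =
    p\<^sup>2 * qform S w + (p * q) * (w \<bullet> (S *v x) + x \<bullet> (S *v w)) + q\<^sup>2 * qform S x" for p q
    by (simp add: qform_def matrix_vector_right_distrib matrix_vector_mult_scaleR inner_add_left
        inner_add_right power2_eq_square algebra_simps)
  have Az: "A *v z = (a * \<xi>) *\<^sub>R w + (b * \<eta>) *\<^sub>R x"
    by (simp add: zab matrix_vector_right_distrib matrix_vector_mult_scaleR w(2) x(2))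
  have "(a * \<xi>) * (b * \<eta>) = a * b" using \<xi>\<eta> by (metis mult.assoc mult.commute mult.right_neutral)
  then have qAz: "qform S (A *v z) = a\<^sup>2 * \<xi>\<^sup>2 * qform S w +
      a * b * (w \<bullet> (S *v x) + x \<bullet> (S *v w)) + b\<^sup>2 * \<eta>\<^sup>2 * qform S x"
    unfolding Az comb by (simp only: power_mult_distrib)
  \<comment> \<open>The mixed terms cancel, and what remains has a positive coefficient at each
    square.\<close>
  have diff: "qform S (A *v z) - qform S z =
     a\<^sup>2 * ((\<xi>\<^sup>2 - 1) * qform S w) + b\<^sup>2 * ((1 - \<eta>\<^sup>2) * (- qform S x))"
    unfolding qAz comb[of a b, folded zab] by (simp add: algebra_simps)
  have "\<xi>\<^sup>2 > 1" "\<eta>\<^sup>2 < 1" using w(3) x(3) abs_square_le_1[of \<xi>] by (simp_all add: abs_square_less_1 not_le)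
  then have p: "(\<xi>\<^sup>2 - 1) * qform S w > 0" "(1 - \<eta>\<^sup>2) * (- qform S x) > 0"
    using w(4) x(4) by (simp_all add: mult_pos_neg)
  have "a \<noteq> 0 \<or> b \<noteq> 0" using z zab by auto
  then have "a\<^sup>2 * ((\<xi>\<^sup>2 - 1) * qform S w) + b\<^sup>2 * ((1 - \<eta>\<^sup>2) * (- qform S x)) > 0"
    using p by (smt (verit) mult_pos_pos mult_nonneg_nonneg zero_le_power2 zero_less_power2)
  then show ?thesis using diff by linarith
qed

text \<open>The constant is the minimum over the unit sphere, attained by compactness. Homogeneity
  carries it to all vectors.\<close>

lemma qform_coercive:
  assumes "\<And>z. z \<noteq> 0 \<Longrightarrow> qform S z > 0"
  shows "\<exists>c>0. \<forall>z. c * (norm z)\<^sup>2 \<le> qform S z"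
proof -
  have "continuous_on (sphere 0 1) (qform S)"
    unfolding qform_def by (intro continuous_intros matrix_vector_mult_linear_continuous_on)
  then obtain m where m: "m \<in> sphere 0 1" "\<And>z. z \<in> sphere 0 1 \<Longrightarrow> qform S m \<le> qform S z"
    using continuous_attains_inf[of "sphere (0::real^2) 1" "qform S"] by auto
  have "qform S m * (norm z)\<^sup>2 \<le> qform S z" for z
  proof (cases "z = 0")
    case False
    have "qform S m \<le> qform S ((1 / norm z) *\<^sub>R z)" by (rule m(2)) (use False in simp)
    then show ?thesis using False by (simp add: qform_scaleR field_simps)
  qed (simp add: qform_def)
  moreover have "qform S m > 0" using assms[of m] m(1) by force
  ultimately show ?thesis by blast
qed

text \<open>One form serves all blocks at once. The eigenvectors of either sign are kept in the
  conclusion because they later supply the boundary directions at every site.\<close>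

lemma source_sink_form:
  fixes A :: "nat \<Rightarrow> real^2^2"
  assumes I: "finite I" "I \<noteq> {}" and det: "\<And>d. d \<in> I \<Longrightarrow> det (A d) = 1"
    and tr: "\<And>d. d \<in> I \<Longrightarrow> \<bar>trace (A d)\<bar> > 2" and ss: "source_sink I A"
  shows "\<exists>S. \<forall>d\<in>I. (\<exists>w \<xi>. w \<noteq> 0 \<and> A d *v w = \<xi> *\<^sub>R w \<and> qform S w > 0) \<and>
     (\<exists>w \<xi>. w \<noteq> 0 \<and> A d *v w = \<xi> *\<^sub>R w \<and> qform S w < 0) \<and>
     (\<forall>z. z \<noteq> 0 \<longrightarrow> qform S z < qform S (A d *v z))"
proof -
  let ?S = "(\<lambda>e. source (A e)) ` I" and ?U = "(\<lambda>e. sink (A e)) ` I"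
  obtain d0 where d0: "d0 \<in> I" using I by auto
  let ?T = "connected_component_set (sphere 0 1 - ?S) (sink (A d0))"
  have "?S \<subseteq> sphere 0 1"
    using source_eigenvector[OF det tr] rp1_in_sphere by (smt (verit) image_subsetI)
  moreover have "?U \<subseteq> ?T" using ss d0 unfolding source_sink_def by auto
  ultimately obtain \<alpha> \<beta> \<gamma> :: real where
    U: "\<And>d. d \<in> I \<Longrightarrow> 0 < \<alpha> + \<beta> * Re (sink (A d)) + \<gamma> * Im (sink (A d))" and
    S: "\<And>d. d \<in> I \<Longrightarrow> \<alpha> + \<beta> * Re (source (A d)) + \<gamma> * Im (source (A d)) < 0"
    using arc_separation[of ?U ?S ?T] I connected_connected_component connected_component_subset
    by (metis (no_types, lifting) finite_imageI image_eqI image_is_empty)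
  define Q where "Q = (vector [vector [\<alpha> + \<beta>, \<gamma>], vector [\<gamma>, \<alpha> - \<beta>]] :: real^2^2)"
  have "(\<exists>w \<xi>. w \<noteq> 0 \<and> A d *v w = \<xi> *\<^sub>R w \<and> qform Q w > 0) \<and>
     (\<exists>w \<xi>. w \<noteq> 0 \<and> A d *v w = \<xi> *\<^sub>R w \<and> qform Q w < 0) \<and>
     (\<forall>z. z \<noteq> 0 \<longrightarrow> qform Q z < qform Q (A d *v z))" if d: "d \<in> I" for d
  proof -
    obtain w \<xi> where w: "w \<noteq> 0" "A d *v w = \<xi> *\<^sub>R w" "\<bar>\<xi>\<bar> > 1" "sink (A d) = rp1 w"
      using sink_eigenvector[OF det[OF d] tr[OF d]] .
    obtain x \<eta> where x: "x \<noteq> 0" "A d *v x = \<eta> *\<^sub>R x" "\<bar>\<eta>\<bar> < 1" "source (A d) = rp1 x"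
      using source_eigenvector[OF det[OF d] tr[OF d]] .
    have "qform Q w > 0"
      using U[OF d] w unfolding Q_def by (subst qform_rp1) (auto intro!: mult_pos_pos)
    moreover have "qform Q x < 0"
      using S[OF d] x unfolding Q_def by (subst qform_rp1) (auto intro!: mult_pos_neg)
    ultimately show ?thesis using w x qform_increasing[OF det[OF d] w(1-3) _ x(1-3)] by blast
  qed
  then show ?thesis by blast
qed

section \<open>Systems with an increasing quadratic form\<close>

lemma qform_bound:
  assumes "\<And>z w. \<bar>z \<bullet> (S *v w)\<bar> \<le> K * (norm z * norm w)"
  shows "\<bar>qform S z\<bar> \<le> K * (norm z)\<^sup>2"
  using assms[of z z] by (simp add: qform_def power2_eq_square)

text \<open>Makes the boundary terms at \<open>- int n\<close> and \<open>int n\<close> of a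
  telescoped sum vanish in the limit.\<close>

lemma sq_summable_tendsto_0:
  fixes z :: "int \<Rightarrow> 'a::real_normed_vector" and h :: "nat \<Rightarrow> int"
  assumes "(\<lambda>i. (norm (z i))\<^sup>2) summable_on UNIV" "inj h"
  shows "(\<lambda>n. (norm (z (h n)))\<^sup>2) \<longlonglongrightarrow> 0"
proof -
  have "(\<lambda>i. (norm (z i))\<^sup>2) summable_on range h"
    using assms(1) by (rule summable_on_subset_banach) auto
  then have "(\<lambda>n. (norm (z (h n)))\<^sup>2) summable_on UNIV"
    using summable_on_reindex[OF assms(2), of "\<lambda>i. (norm (z i))\<^sup>2"] unfolding o_def by simp
  then show ?thesis by (intro summable_LIMSEQ_zero summable_on_imp_summable)
qed

lemma finite_int_subset_window:
  fixes F :: "int set"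
  assumes "finite F"
  obtains N :: nat where "\<And>n. n \<ge> N \<Longrightarrow> F \<subseteq> {- int n..<int n}"
proof -
  obtain M where M: "\<And>i. i \<in> F \<Longrightarrow> \<bar>i\<bar> \<le> M"
    using finite_imageI[OF assms, of abs] by (meson bdd_above_finite bdd_above.E imageI)
  show thesis
    by (rule that[of "nat M + 1"]) (use M in \<open>fastforce simp: abs_le_iff\<close>)
qed

text \<open>The forms \<open>S i\<close> act as Lyapunov functions with uniform gain
  \<open>c\<close> along the recursion. The two direction assumptions provide the boundary
  conditions for solving it on finite windows.\<close>

locale form_monotone =
  fixes P S :: "int \<Rightarrow> real^2^2" and K c :: real
  assumes c: "c > 0"
    and P_bound: "norm (P i *v z) \<le> K * norm z"
    and S_bound: "\<bar>z \<bullet> (S i *v w)\<bar> \<le> K * (norm z * norm w)"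
    and mono: "c * (norm z)\<^sup>2 \<le> qform (S (i + 1)) (P i *v z) - qform (S i) z"
    and nonneg_direction: "\<exists>e. e \<noteq> 0 \<and> qform (S i) e \<ge> 0"
    and nonpos_direction: "\<exists>e. e \<noteq> 0 \<and> qform (S i) e \<le> 0"
begin

definition "C\<^sub>1 = 2 * K ^ 4 / c + K"

lemma K_nonneg: "K \<ge> 0"
  using order_trans[OF norm_ge_zero P_bound[of 0 "axis 1 1"]] by (simp add: norm_axis_1)

lemma C\<^sub>1_nonneg: "C\<^sub>1 \<ge> 0"
  unfolding C\<^sub>1_def using c K_nonneg by simp

text \<open>Half of the gain \<open>c\<close> absorbs the cross terms between
  \<open>P i *v z\<close> and \<open>h\<close>, at the price of the constant
  \<open>C\<^sub>1\<close> in front of the forcing.\<close>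

lemma one_step:
  assumes "z' = P i *v z - h"
  shows "c / 2 * (norm z)\<^sup>2 \<le> qform (S (i + 1)) z' - qform (S i) z + C\<^sub>1 * (norm h)\<^sup>2"
proof -
  let ?a = "P i *v z" and ?S = "S (i + 1)"
  have "qform ?S z' = qform ?S ?a - ?a \<bullet> (?S *v h) - h \<bullet> (?S *v ?a) + qform ?S h"
    unfolding assms qform_def
    by (simp add: matrix_vector_mult_diff_distrib inner_diff_left inner_diff_right)
  moreover have "\<bar>?a \<bullet> (?S *v h)\<bar> \<le> K * (norm ?a * norm h)" "\<bar>h \<bullet> (?S *v ?a)\<bar> \<le> K * (norm ?a * norm h)"
    using S_bound[of ?a "i + 1" h] S_bound[of h "i + 1" ?a] by (simp_all add: mult.commute)
  moreover have "\<bar>qform ?S h\<bar> \<le> K * (norm h)\<^sup>2" using S_bound by (rule qform_bound)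
  moreover have "K * (norm ?a * norm h) \<le> K * ((K * norm z) * norm h)"
    using P_bound K_nonneg by (intro mult_left_mono mult_right_mono) auto
  moreover have "2 * (K * ((K * norm z) * norm h)) \<le> c / 2 * (norm z)\<^sup>2 + 2 * K ^ 4 / c * (norm h)\<^sup>2"
  proof -
    \<comment> \<open>Young's inequality, with the square weighted so that the coefficient of
      \<open>(norm z)\<^sup>2\<close> is exactly \<open>c / 2\<close>.\<close>
    have "0 \<le> (c * norm z - 2 * K\<^sup>2 * norm h)\<^sup>2 / (2 * c)" using c by simp
    also have "\<dots> = c / 2 * (norm z)\<^sup>2 + 2 * K ^ 4 / c * (norm h)\<^sup>2 - 2 * (K * ((K * norm z) * norm h))"
      using c by (simp add: field_simps power2_eq_square power4_eq_xxxx)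
    finally show ?thesis by simp
  qed
  moreover note mono[of z i]
  ultimately show ?thesis unfolding C\<^sub>1_def by (simp add: distrib_right)
qed

lemma window_bound:
  assumes "m \<le> n" "\<And>i. m \<le> i \<Longrightarrow> i < n \<Longrightarrow> z (i + 1) = P i *v z i - h i"
  shows "c / 2 * (\<Sum>i\<in>{m..<n}. (norm (z i))\<^sup>2) \<le>
    qform (S n) (z n) - qform (S m) (z m) + C\<^sub>1 * (\<Sum>i\<in>{m..<n}. (norm (h i))\<^sup>2)"
  using assms
proof (induction n rule: int_ge_induct)
  case (step n)
  have "{m..<n + 1} = insert n {m..<n}" using step.hyps by auto
  moreover have "c / 2 * (norm (z n))\<^sup>2 \<le>
      qform (S (n + 1)) (z (n + 1)) - qform (S n) (z n) + C\<^sub>1 * (norm (h n))\<^sup>2"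
    using step.prems step.hyps by (intro one_step) auto
  ultimately show ?case using step.IH step.prems by (simp add: distrib_left)
qed simp

text \<open>Telescoping over growing windows: as \<open>z\<close> is square summable, the forms at
  both ends tend to 0 and only the forcing remains.\<close>

lemma energy_bound:
  assumes rec: "\<And>i. z (i + 1) = P i *v z i - h i"
    and z: "(\<lambda>i. (norm (z i))\<^sup>2) summable_on UNIV"
    and h: "\<And>F. finite F \<Longrightarrow> (\<Sum>i\<in>F. (norm (h i))\<^sup>2) \<le> H" and "finite F"
  shows "(\<Sum>i\<in>F. (norm (z i))\<^sup>2) \<le> 2 * C\<^sub>1 / c * H"
proof -
  obtain N where N: "\<And>n::nat. n \<ge> N \<Longrightarrow> F \<subseteq> {- int n..<int n}"
    using finite_int_subset_window[OF \<open>finite F\<close>] by blast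
  have "c / 2 * (\<Sum>i\<in>F. (norm (z i))\<^sup>2) \<le>
      K * (norm (z (int n)))\<^sup>2 + K * (norm (z (- int n)))\<^sup>2 + C\<^sub>1 * H" if "n \<ge> N" for n
  proof -
    have "c / 2 * (\<Sum>i\<in>F. (norm (z i))\<^sup>2) \<le> c / 2 * (\<Sum>i\<in>{- int n..<int n}. (norm (z i))\<^sup>2)"
      using c N[OF that] by (intro mult_left_mono sum_mono2) auto
    also have "\<dots> \<le> qform (S (int n)) (z (int n)) - qform (S (- int n)) (z (- int n))
        + C\<^sub>1 * (\<Sum>i\<in>{- int n..<int n}. (norm (h i))\<^sup>2)"
      using rec by (intro window_bound) auto
    also have "C\<^sub>1 * (\<Sum>i\<in>{- int n..<int n}. (norm (h i))\<^sup>2) \<le> C\<^sub>1 * H"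
      using h C\<^sub>1_nonneg by (intro mult_left_mono) auto
    finally show ?thesis
      using qform_bound[OF S_bound, of "int n" "z (int n)"]
        qform_bound[OF S_bound, of "- int n" "z (- int n)"] by linarith
  qed
  moreover have "(\<lambda>n. K * (norm (z (int n)))\<^sup>2 + K * (norm (z (- int n)))\<^sup>2 + C\<^sub>1 * H)
      \<longlonglongrightarrow> K * 0 + K * 0 + C\<^sub>1 * H"
    by (intro tendsto_intros sq_summable_tendsto_0[OF z]) (auto simp: inj_def)
  ultimately have "c / 2 * (\<Sum>i\<in>F. (norm (z i))\<^sup>2) \<le> K * 0 + K * 0 + C\<^sub>1 * H"
    by (intro LIMSEQ_le_const) blast+
  then show ?thesis using c by (simp add: field_simps)
qed

lemma initial_value:
  fixes m :: int
  obtains z where "z m = v" "\<And>i. m \<le> i \<Longrightarrow> z (i + 1) = P i *v z i - h i"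
proof -
  define Z where "Z = rec_nat v (\<lambda>k y. P (m + int k) *v y - h (m + int k))"
  show thesis
  proof (rule that[of "\<lambda>i. Z (nat (i - m))"])
    show "Z (nat (m - m)) = v" by (simp add: Z_def)
    fix i assume "m \<le> i"
    then have "nat (i + 1 - m) = Suc (nat (i - m))" "m + int (nat (i - m)) = i" by auto
    then show "Z (nat (i + 1 - m)) = P i *v Z (nat (i - m)) - h i" by (simp add: Z_def)
  qed
qed

text \<open>Shooting method: to the solution \<open>Y\<close> that starts at 0 one adds the multiple
  of a homogeneous solution \<open>E\<close>, started in a nonnegative direction, that brings the
  end point onto the line of a nonpositive direction.\<close>

lemma boundary_value:
  assumes "m < n"
  obtains z where "\<And>i. m \<le> i \<Longrightarrow> i < n \<Longrightarrow> z (i + 1) = P i *v z i - h i"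
    "qform (S m) (z m) \<ge> 0" "qform (S n) (z n) \<le> 0"
proof -
  obtain e where e: "e \<noteq> 0" "qform (S m) e \<ge> 0" using nonneg_direction by blast
  obtain e' where e': "e' \<noteq> 0" "qform (S n) e' \<le> 0" using nonpos_direction by blast
  obtain E where E: "E m = e" "\<And>i. m \<le> i \<Longrightarrow> E (i + 1) = P i *v E i - 0"
    using initial_value[of m e "\<lambda>_. 0"] by auto
  obtain Y where Y: "Y m = 0" "\<And>i. m \<le> i \<Longrightarrow> Y (i + 1) = P i *v Y i - h i"
    using initial_value[of m 0 h] by auto
  \<comment> \<open>Without forcing the form grows strictly from a nonnegative value, so it is
    positive at \<open>n\<close>. Hence \<open>E n\<close> is off the line of \<open>e'\<close> and
    the multiple \<open>t\<close> exists.\<close>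
  have "c / 2 * (\<Sum>i\<in>{m..<n}. (norm (E i))\<^sup>2) \<le>
    qform (S n) (E n) - qform (S m) (E m) + C\<^sub>1 * (\<Sum>i\<in>{m..<n}. (norm (0::real^2))\<^sup>2)"
    using assms E(2) by (intro window_bound) auto
  moreover have "(\<Sum>i\<in>{m..<n}. (norm (E i))\<^sup>2) \<ge> (norm (E m))\<^sup>2"
    using assms by (intro member_le_sum) auto
  then have "c / 2 * (\<Sum>i\<in>{m..<n}. (norm (E i))\<^sup>2) > 0"
    using e(1) c E(1) by (intro mult_pos_pos) (auto intro: less_le_trans[of 0 "(norm e)\<^sup>2"])
  ultimately have En: "qform (S n) (E n) > 0" using e(2) E(1) by simp
  define \<delta> where "\<delta> x = e'$1 * x$2 - e'$2 * x$1" for x :: "real^2"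
  have "\<delta> (E n) \<noteq> 0"
  proof
    assume "\<delta> (E n) = 0"
    then obtain k where "E n = k *\<^sub>R e'" using parallel_2[OF e'(1)] unfolding \<delta>_def by blast
    then have "qform (S n) (E n) = k\<^sup>2 * qform (S n) e'" by (simp add: qform_scaleR)
    then show False using En e'(2) by (smt (verit) mult_nonneg_nonpos zero_le_power2)
  qed
  define t where "t = - \<delta> (Y n) / \<delta> (E n)"
  define z where "z i = Y i + t *\<^sub>R E i" for i
  have "\<delta> (z n) = \<delta> (Y n) + t * \<delta> (E n)" by (simp add: z_def \<delta>_def algebra_simps)
  also have "\<dots> = 0" using \<open>\<delta> (E n) \<noteq> 0\<close> by (simp add: t_def)
  finally obtain k where k: "z n = k *\<^sub>R e'"
    using parallel_2[OF e'(1)] unfolding \<delta>_def by blast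
  show thesis
  proof (rule that[of z])
    show "z (i + 1) = P i *v z i - h i" if "m \<le> i" "i < n" for i
      using E(2) Y(2) that
      by (simp add: z_def matrix_vector_right_distrib matrix_vector_mult_scaleR)
    show "qform (S m) (z m) \<ge> 0" using E(1) Y(1) e(2) by (simp add: z_def qform_scaleR)
    show "qform (S n) (z n) \<le> 0" using e'(2) by (simp add: k qform_scaleR mult_nonneg_nonpos)
  qed
qed

text \<open>With the boundary signs of \<open>boundary_value\<close> the form terms are at most 0,
  so the bound does not depend on the size of the window.\<close>

lemma windowed_solution:
  assumes h: "\<And>F. finite F \<Longrightarrow> (\<Sum>i\<in>F. (norm (h i))\<^sup>2) \<le> H"
  obtains z where "\<And>i. - int n \<le> i \<Longrightarrow> i < int n - 1 \<Longrightarrow> z (i + 1) = P i *v z i - h i"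
    "\<And>F. finite F \<Longrightarrow> (\<Sum>i\<in>F. (norm (z i))\<^sup>2) \<le> 2 * C\<^sub>1 / c * H"
proof (cases "n = 0")
  case True
  have "0 \<le> H" using h[of "{}"] by simp
  then have "0 \<le> 2 * C\<^sub>1 / c * H" using C\<^sub>1_nonneg c by simp
  then show thesis using that[of "\<lambda>_. 0"] True by simp
next
  case False
  then obtain y where y: "\<And>i. - int n \<le> i \<Longrightarrow> i < int n \<Longrightarrow> y (i + 1) = P i *v y i - h i"
    "qform (S (- int n)) (y (- int n)) \<ge> 0" "qform (S (int n)) (y (int n)) \<le> 0"
    using boundary_value[of "- int n" "int n" h] by auto
  \<comment> \<open>Extension by zero discards the value at \<open>int n\<close>, so the recursion
    survives only for \<open>i < int n - 1\<close>.\<close>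
  define z where "z i = (if i \<in> {- int n..<int n} then y i else 0)" for i
  show thesis
  proof (rule that[of z])
    show "z (i + 1) = P i *v z i - h i" if "- int n \<le> i" "i < int n - 1" for i
      using y(1)[of i] that by (simp add: z_def)
    fix F :: "int set" assume F: "finite F"
    have "(\<Sum>i\<in>F. (norm (z i))\<^sup>2) = (\<Sum>i\<in>F \<inter> {- int n..<int n}. (norm (y i))\<^sup>2)"
      using F by (intro sum.mono_neutral_cong_right) (auto simp: z_def)
    also have "\<dots> \<le> (\<Sum>i\<in>{- int n..<int n}. (norm (y i))\<^sup>2)" by (intro sum_mono2) auto
    finally have "c / 2 * (\<Sum>i\<in>F. (norm (z i))\<^sup>2) \<le> c / 2 * (\<Sum>i\<in>{- int n..<int n}. (norm (y i))\<^sup>2)"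
      using c by simp
    also have "\<dots> \<le> qform (S (int n)) (y (int n)) - qform (S (- int n)) (y (- int n))
        + C\<^sub>1 * (\<Sum>i\<in>{- int n..<int n}. (norm (h i))\<^sup>2)"
      using y(1) by (intro window_bound) auto
    also have "\<dots> \<le> C\<^sub>1 * (\<Sum>i\<in>{- int n..<int n}. (norm (h i))\<^sup>2)" using y(2,3) by simp
    also have "\<dots> \<le> C\<^sub>1 * H" using h C\<^sub>1_nonneg by (intro mult_left_mono) auto
    finally show "(\<Sum>i\<in>F. (norm (z i))\<^sup>2) \<le> 2 * C\<^sub>1 / c * H" using c by (simp add: field_simps)
  qed
qed

text \<open>Compactness: the windowed solutions are uniformly bounded at each site, so a subsequence
  converges pointwise. The recursion and the bounds on finite sums pass to the limit.\<close>

lemma solution_exists: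
  assumes h: "\<And>F. finite F \<Longrightarrow> (\<Sum>i\<in>F. (norm (h i))\<^sup>2) \<le> H"
  obtains z where "\<And>i. z (i + 1) = P i *v z i - h i"
    "\<And>F. finite F \<Longrightarrow> (\<Sum>i\<in>F. (norm (z i))\<^sup>2) \<le> 2 * C\<^sub>1 / c * H"
proof -
  let ?H = "2 * C\<^sub>1 / c * H"
  have "\<exists>z. (\<forall>i. - int n \<le> i \<longrightarrow> i < int n - 1 \<longrightarrow> z (i + 1) = P i *v z i - h i) \<and>
    (\<forall>F. finite F \<longrightarrow> (\<Sum>i\<in>F. (norm (z i))\<^sup>2) \<le> ?H)" for n
    using windowed_solution[OF h, of n] by metis
  then obtain Z where Z: "\<And>n i. - int n \<le> i \<Longrightarrow> i < int n - 1 \<Longrightarrow> Z n (i + 1) = P i *v Z n i - h i"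
    "\<And>n F. finite F \<Longrightarrow> (\<Sum>i\<in>F. (norm (Z n i))\<^sup>2) \<le> ?H" by metis
  \<comment> \<open>A product of balls is compact by Tychonoff, and over the countable index set
    this gives sequential compactness.\<close>
  let ?X = "Pi\<^sub>E UNIV (\<lambda>_::int. cball (0::real^2) (sqrt ?H))"
  have "Z n \<in> ?X" for n
  proof -
    have "(norm (Z n i))\<^sup>2 \<le> ?H" for i using Z(2)[of "{i}" n] by simp
    then show ?thesis by (auto intro!: real_le_rsqrt simp del: real_sqrt_le_iff)
  qed
  moreover have "compact ?X"
    using compactin_PiE[of "\<lambda>_. euclidean" UNIV "\<lambda>_::int. cball (0::real^2) (sqrt ?H)"]
    by (simp add: euclidean_product_topology)
  then have "seq_compact ?X" by (rule compact_imp_seq_compact)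
  ultimately obtain z r where z: "strict_mono r" "(Z \<circ> r) \<longlonglongrightarrow> z"
    unfolding seq_compact_def by blast
  have lim: "(\<lambda>n. Z (r n) i) \<longlonglongrightarrow> z i" for i
  proof -
    have "continuous_on UNIV (\<lambda>f::int \<Rightarrow> real^2. f i)" by (rule continuous_on_product_coordinates)
    then have "isCont (\<lambda>f::int \<Rightarrow> real^2. f i) z" 
      using continuous_on_eq_continuous_at[of UNIV] by blast
    from isCont_tendsto_compose[OF this z(2)] show ?thesis by (simp add: o_def)
  qed
  show thesis
  proof (rule that[of z])
    fix i
    have "\<forall>\<^sub>F n in sequentially. Z (r n) (i + 1) = P i *v Z (r n) i - h i"
    proof (rule eventually_sequentiallyI[of "nat \<bar>i\<bar> + 2"])
      fix n assume "nat \<bar>i\<bar> + 2 \<le> n"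
      moreover have "n \<le> r n" using z(1) by (rule seq_suble)
      ultimately show "Z (r n) (i + 1) = P i *v Z (r n) i - h i" by (intro Z(1)) linarith+
    qed
    moreover have "(\<lambda>n. P i *v Z (r n) i - h i) \<longlonglongrightarrow> P i *v z i - h i"
      by (intro tendsto_intros isCont_tendsto_compose[OF matrix_vector_mult_linear_continuous_at lim])
    ultimately have "(\<lambda>n. Z (r n) (i + 1)) \<longlonglongrightarrow> P i *v z i - h i"
      by (simp add: tendsto_cong)
    then show "z (i + 1) = P i *v z i - h i" using lim LIMSEQ_unique by blast
  next
    fix F :: "int set" assume "finite F"
    then show "(\<Sum>i\<in>F. (norm (z i))\<^sup>2) \<le> ?H"
      using Z(2) by (intro LIMSEQ_le_const2[of "\<lambda>n. \<Sum>i\<in>F. (norm (Z (r n) i))\<^sup>2"])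
        (auto intro!: tendsto_intros lim)
  qed
qed

end

section \<open>Propagation along the resonator chain\<close>

lemma block_start_succ:
  "block_start B chi (j + 1) = block_start B chi j + int (length (B (chi j)))"
proof -
  consider "j \<ge> 0" | "j = - 1" | "j < - 1" by linarith
  then show ?thesis
  proof cases
    case 1
    then have "{0..<j + 1} = insert j {0..<j}" by auto
    then show ?thesis using 1 by (simp add: block_start_def)
  next
    case 2
    \<comment> \<open>Here the two branches of \<open>block_start\<close> meet, since
      \<open>j + 1 = 0\<close>.\<close>
    then have "{j..<0} = {j}" by auto
    then show ?thesis using 2 by (simp add: block_start_def)
  next
    case 3
    then have "{j..<0} = insert j {j + 1..<0}" by auto
    then show ?thesis using 3 by (simp add: block_start_def)
  qed
qed

locale resonator_chain =
  fixes D :: nat and B :: "nat \<Rightarrow> resonator list" and chi :: "int \<Rightarrow> nat" and lam :: real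
  assumes valid: "valid_blocks D B" and chi: "\<forall>j. chi j \<in> {1..D}"
begin

abbreviation "bs \<equiv> block_start B chi"

lemma block_nonempty: "d \<in> {1..D} \<Longrightarrow> length (B d) > 0"
  using valid unfolding valid_blocks_def by auto

lemma block_length_pos: "length (B (chi j)) > 0"
  using chi block_nonempty by blast

lemma bs_mono: "j \<le> j' \<Longrightarrow> bs j \<le> bs j'"
  by (induction j' rule: int_ge_induct) (auto simp: block_start_succ)

lemma position_unique:
  assumes "bs j \<le> i" "i < bs (j + 1)" "bs j' \<le> i" "i < bs (j' + 1)"
  shows "j = j'"
  using bs_mono[of "j + 1" j'] bs_mono[of "j' + 1" j] assms by (cases j j' rule: linorder_cases) auto

text \<open>Induction from site 0 in both directions. Blocks are nonempty, so moving by one site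
  changes the block index by at most one.\<close>

lemma position_exists: "\<exists>j. bs j \<le> i \<and> i < bs (j + 1)"
proof (induction i rule: int_induct[where k = 0])
  case base
  show ?case
    using block_length_pos[of 0] by (intro exI[of _ 0]) (simp only: block_start_succ, simp add: block_start_def)
next
  case (step1 i)
  then obtain j where j: "bs j \<le> i" "i < bs (j + 1)" by auto
  show ?case
  proof (cases "i + 1 < bs (j + 1)")
    case False
    then show ?thesis using j block_length_pos[of "j + 1"] block_start_succ[of B chi "j + 1"]
      by (intro exI[of _ "j + 1"] conjI) linarith+
  qed (use j in \<open>intro exI[of _ j], auto\<close>)
next
  case (step2 i)
  then obtain j where j: "bs j \<le> i" "i < bs (j + 1)" by auto
  show ?case
  proof (cases "bs j \<le> i - 1")
    case False
    then show ?thesis using j block_length_pos[of "j - 1"] block_start_succ[of B chi "j - 1"]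
      by (intro exI[of _ "j - 1"]) simp
  qed (use j in \<open>intro exI[of _ j], auto\<close>)
qed

lemma position:
  obtains j k where "i = bs j + int k" "k < length (B (chi j))"
proof -
  obtain j where "bs j \<le> i" "i < bs (j + 1)" using position_exists by blast
  then show thesis using that[of j "nat (i - bs j)"] by (simp add: block_start_succ)
qed

lemma position_inj:
  assumes "bs j + int k = bs j' + int k'" "k < length (B (chi j))" "k' < length (B (chi j'))"
  shows "j = j'" "k = k'"
proof -
  show "j = j'"
    using assms by (intro position_unique[of j "bs j + int k"]) (auto simp: block_start_succ)
  then show "k = k'" using assms(1) by simp
qed

lemma res_seq_block:
  assumes "k < length (B (chi j))"
  shows "res_seq B chi (bs j + int k) = B (chi j) ! k"
proof -
  have "(THE j'. bs j' \<le> bs j + int k \<and> bs j + int k < bs (j' + 1)) = j"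
    using assms position_unique by (intro the_equality) (auto simp: block_start_succ)
  then show ?thesis by (simp add: res_seq_def)
qed

definition resonators :: "resonator set" where
  "resonators = (\<Union>d\<in>{1..D}. set (B d))"

lemma finite_resonators: "finite resonators"
  by (simp add: resonators_def)

lemma res_seq_in: "res_seq B chi i \<in> resonators"
proof -
  obtain j k where "i = bs j + int k" "k < length (B (chi j))" by (rule position)
  then show ?thesis using res_seq_block[of k j] chi nth_mem unfolding resonators_def by fastforce
qed

lemma resonators_pos:
  assumes "r \<in> resonators"
  shows "res_v r > 0" "res_l r > 0" "res_s r > 0"
  using assms valid unfolding valid_blocks_def resonators_def by auto

section \<open>The Jacobi operator in rescaled variables\<close>

abbreviation "sp i \<equiv> res_s (res_seq B chi i)"

text \<open>The weight that symmetrises the operator: the off-diagonal entries are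
  \<open>- \<rho> i * \<rho> (i + 1) / sp i\<close>, so after rescaling by \<rho> only the spacings
  enter the differences.\<close>

definition \<rho> :: "int \<Rightarrow> real" where
  "\<rho> i = res_v (res_seq B chi i) / sqrt (res_l (res_seq B chi i))"

lemma sp_pos: "sp i > 0"
  and \<rho>_pos: "\<rho> i > 0"
  using resonators_pos[OF res_seq_in] by (simp_all add: \<rho>_def)

lemma \<rho>_sq: "(\<rho> i)\<^sup>2 = (res_v (res_seq B chi i))\<^sup>2 / res_l (res_seq B chi i)"
  using resonators_pos[OF res_seq_in, of i] by (simp add: \<rho>_def power_divide)

lemma jac_a_eq: "jac_a B chi i = - (\<rho> i * \<rho> (i + 1) / sp i)"
  by (simp add: jac_a_def \<rho>_def Let_def real_sqrt_mult mult_ac)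

lemma jac_b_eq: "jac_b B chi i = (\<rho> i)\<^sup>2 * (1 / sp (i - 1) + 1 / sp i)"
  by (simp add: jac_b_def \<rho>_sq Let_def)

text \<open>Only finitely many different resonators occur along the chain. A single sum of positive
  quantities bounds each of them.\<close>

lemma uniform_bound:
  obtains M where "M \<ge> 1" "\<And>i. sp i \<le> M" "\<And>i. 1 / sp i \<le> M" "\<And>i. \<rho> i \<le> M" "\<And>i. 1 / \<rho> i \<le> M"
proof -
  define f where "f r = 1 + res_s r + 1 / res_s r + res_v r / sqrt (res_l r) + 1 / (res_v r / sqrt (res_l r))"
    for r
  obtain M where M: "\<And>r. r \<in> resonators \<Longrightarrow> f r \<le> M"
    using finite_imageI[OF finite_resonators, of f] by (meson bdd_above_finite bdd_above.E imageI)
  have f: "1 + sp i + 1 / sp i + \<rho> i + 1 / \<rho> i \<le> M" for i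
    using M[OF res_seq_in, of i] by (simp add: f_def \<rho>_def)
  have pos: "sp i > 0" "1 / sp i > 0" "\<rho> i > 0" "1 / \<rho> i > 0" for i
    using sp_pos \<rho>_pos by auto
  show thesis
  proof (rule that[of M])
    show "M \<ge> 1" using f[of 0] pos[of 0] by linarith
    fix i
    show "sp i \<le> M" "1 / sp i \<le> M" "\<rho> i \<le> M" "1 / \<rho> i \<le> M"
      using f[of i] pos[of i] by linarith+
  qed
qed

text \<open>In the variable \<open>x = \<rho> u\<close> the Jacobi operator is a weighted second difference.\<close>

lemma jacobi_flux:
  fixes u :: "int \<Rightarrow> 'a::real_normed_field"
  defines "x \<equiv> \<lambda>i. of_real (\<rho> i) * u i"
  shows "of_real (jac_a B chi (i - 1)) * u (i - 1) + of_real (jac_a B chi i) * u (i + 1)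
     + of_real (jac_b B chi i) * u i - of_real lam * u i =
    of_real (\<rho> i) * ((x i - x (i - 1)) / of_real (sp (i - 1)) - (x (i + 1) - x i) / of_real (sp i)
      - of_real (res_l (res_seq B chi i) / (res_v (res_seq B chi i))\<^sup>2 * lam) * x i)"
proof -
  \<comment> \<open>As \<rho> squared is \<open>v^2 / l\<close>, the spectral parameter splits into
    two factors \<rho> around the entry of the propagation matrix.\<close>
  have "\<rho> i * (res_l (res_seq B chi i) / (res_v (res_seq B chi i))\<^sup>2 * lam * \<rho> i) =
      (\<rho> i)\<^sup>2 * (res_l (res_seq B chi i) / (res_v (res_seq B chi i))\<^sup>2) * lam"
    by (simp add: power2_eq_square)
  also have "\<dots> = lam"
    unfolding \<rho>_sq using resonators_pos[OF res_seq_in, of i] by simp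
  finally have l: "of_real lam = of_real (\<rho> i) * (of_real (res_l (res_seq B chi i) / (res_v (res_seq B chi i))\<^sup>2 * lam) * of_real (\<rho> i) :: 'a)"
    by (metis of_real_mult)
  show ?thesis
    unfolding x_def jac_a_eq jac_b_eq l
    by (simp add: divide_inverse power2_eq_square algebra_simps)
qed

end

section \<open>Propagation matrices and interpolated forms\<close>

lemma prop_mat_mult:
  "prop_mat lam r *v z = vector [(1 - res_s r * (res_l r / (res_v r)\<^sup>2 * lam)) * z$1 + res_s r * z$2,
     - (res_l r / (res_v r)\<^sup>2 * lam) * z$1 + z$2]"
  by (simp add: prop_mat_def Let_def vec_eq_iff forall_2 matrix_vector_mult_def sum_2)

lemma det_prop_mat: "det (prop_mat lam r) = 1"
  by (simp add: prop_mat_def Let_def det_2)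

lemma block_prop_Nil: "block_prop lam [] = mat 1"
  by (simp add: block_prop_def)

lemma block_prop_snoc: "block_prop lam (rs @ [r]) = prop_mat lam r ** block_prop lam rs"
  by (simp add: block_prop_def)

lemma det_block_prop: "det (block_prop lam rs) = 1"
  by (induction rs rule: rev_induct)
    (simp_all add: block_prop_Nil block_prop_snoc det_mul det_prop_mat)

lemma qform_congruence: "qform (transpose N ** S ** N) z = qform S (N *v z)"
  unfolding qform_def matrix_vector_mul_assoc[symmetric] transpose_matrix_vector
  by (metis dot_lmul_matrix inner_commute)

lemma qform_add: "qform (S + S') z = qform S z + qform S' z"
  and qform_diff: "qform (S - S') z = qform S z - qform S' z"
  and qform_scaleR_left: "qform (a *\<^sub>R S) z = a * qform S z"
  by (simp_all add: qform_2 algebra_simps)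

lemma finite_uniform_large:
  fixes Q :: "'a \<Rightarrow> real \<Rightarrow> bool"
  assumes "finite X" "\<And>x. x \<in> X \<Longrightarrow> \<exists>K. Q x K"
    and "\<And>x K K'. Q x K \<Longrightarrow> K \<le> K' \<Longrightarrow> Q x K'"
  shows "\<exists>K. \<forall>x\<in>X. Q x K"
  using assms(1,2)
proof (induction X rule: finite_induct)
  case (insert x X)
  obtain K where "\<forall>x\<in>X. Q x K" using insert by blast
  moreover obtain K' where "Q x K'" using insert.prems by blast
  ultimately have "\<forall>y\<in>insert x X. Q y (max K K')" using assms(3) by (metis insertE max.cobounded1 max.cobounded2)
  then show ?case by blast
qed simp

lemma finite_uniform_small:
  fixes Q :: "'a \<Rightarrow> real \<Rightarrow> bool"
  assumes "finite X" "\<And>x. x \<in> X \<Longrightarrow> \<exists>c>0. Q x c"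
    and "\<And>x c c'. Q x c \<Longrightarrow> c' \<le> c \<Longrightarrow> Q x c'"
  shows "\<exists>c>0. \<forall>x\<in>X. Q x c"
  using assms(1,2)
proof (induction X rule: finite_induct)
  case (insert x X)
  obtain c where c: "c > 0" "\<forall>x\<in>X. Q x c" using insert by blast
  obtain c' where c': "c' > 0" "Q x c'" using insert.prems by blast
  have "\<forall>y\<in>insert x X. Q y (min c c')"
    using c c' assms(3) by (metis insertE min.cobounded1 min.cobounded2)
  then show ?case using c c' by (intro exI[of _ "min c c'"]) auto
qed (use zero_less_one in blast)

text \<open>Inside a block, interpolate linearly in \<open>k\<close> between the form at the start and its pullback
  under the whole block, transported to the site \<open>k\<close>.\<close>

lemma block_forms:
  fixes S :: "real^2^2"
  assumes ne: "rs \<noteq> []" and inc: "\<And>z. z \<noteq> 0 \<Longrightarrow> qform S z < qform S (block_prop lam rs *v z)"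
    and w: "w \<noteq> 0" "block_prop lam rs *v w = \<xi> *\<^sub>R w" "qform S w > 0"
    and x: "x \<noteq> 0" "block_prop lam rs *v x = \<eta> *\<^sub>R x" "qform S x < 0"
  shows "\<exists>Sf c. c > 0 \<and> Sf 0 = S \<and> Sf (length rs) = S \<and>
    (\<forall>k<length rs. \<forall>z. c * (norm z)\<^sup>2 \<le>
       qform (Sf (Suc k)) (prop_mat lam (rs ! k) *v z) - qform (Sf k) z) \<and>
    (\<forall>k\<le>length rs. (\<exists>e. e \<noteq> 0 \<and> 0 \<le> qform (Sf k) e) \<and> (\<exists>e. e \<noteq> 0 \<and> qform (Sf k) e \<le> 0))"
proof -
  define L where "L = length rs"
  have L: "L > 0" using ne by (simp add: L_def)
  define A where "A = block_prop lam rs"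
  define M where "M k = block_prop lam (take k rs)" for k
  define N where "N k = matrix_inv (M k)" for k
  define t where "t k = real k / real L" for k
  define Sf where "Sf k = (1 - t k) *\<^sub>R (transpose (N k) ** S ** N k)
     + t k *\<^sub>R (transpose (A ** N k) ** S ** (A ** N k))" for k
  have inv: "invertible (M k)" for k by (simp add: invertible_det_nz M_def det_block_prop)
  have NM: "N k ** M k = mat 1" and MN: "M k ** N k = mat 1" for k
    unfolding N_def matrix_inv_def using someI_ex[OF inv[of k, unfolded invertible_def]] by auto
  have NMv: "N k *v (M k *v z) = z" and MNv: "M k *v (N k *v z) = z" for k z
    by (simp_all add: matrix_vector_mul_assoc NM MN)
  have M_0: "M 0 = mat 1" by (simp add: M_def block_prop_Nil)
  have M_L: "M L = A" by (simp add: M_def L_def A_def)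
  have MS: "M (Suc k) *v z = prop_mat lam (rs ! k) *v (M k *v z)" if "k < L" for k z
    using that
    by (simp add: M_def L_def take_Suc_conv_app_nth block_prop_snoc matrix_vector_mul_assoc)
  \<comment> \<open>Seen from the start of the block, \<open>Sf k\<close> is the weighted mean of
    the form before and after the whole block.\<close>
  have q: "qform (Sf k) (M k *v z) = (1 - t k) * qform S z + t k * qform S (A *v z)" for k z
    by (simp add: Sf_def qform_add qform_scaleR_left qform_congruence NMv flip: matrix_vector_mul_assoc)
  have M_nz: "M k *v z \<noteq> 0" if "z \<noteq> 0" for k z
    using NMv[of k z] that by (metis matrix_vector_mult_0_right)
  have t: "0 \<le> t k" "t k \<le> 1" if "k \<le> L" for k using that L by (auto simp: t_def)
  have S0: "Sf 0 = S"
    using NM[of 0] M_0 by (simp add: Sf_def t_def transpose_mat)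
  \<comment> \<open>At the end of the block \<open>A ** N L\<close> is the identity, so the original
    form returns and forms of successive blocks fit together.\<close>
  have SL: "Sf L = S"
    using MN[of L] M_L L by (simp add: Sf_def t_def transpose_mat)
  have "\<exists>c>0. \<forall>z. c * (norm z)\<^sup>2 \<le>
       qform (Sf (Suc k)) (prop_mat lam (rs ! k) *v z) - qform (Sf k) z" if k: "k < L" for k
  proof -
    let ?P = "prop_mat lam (rs ! k)"
    have "qform (transpose ?P ** Sf (Suc k) ** ?P - Sf k) z > 0" if "z \<noteq> 0" for z
    proof -
      define y where "y = N k *v z"
      have z: "z = M k *v y" by (simp add: y_def MNv)
      then have "y \<noteq> 0" using that by auto
      \<comment> \<open>The weights rise by \<open>1 / L\<close> per site, so each site receives an
        equal share of the increase over the block.\<close>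
      have "qform (transpose ?P ** Sf (Suc k) ** ?P - Sf k) z =
          (t (Suc k) - t k) * (qform S (A *v y) - qform S y)"
        unfolding qform_diff qform_congruence z MS[OF k, symmetric] q by (simp add: algebra_simps)
      also have "\<dots> > 0"
        using inc[OF \<open>y \<noteq> 0\<close>] L unfolding A_def
        by (intro mult_pos_pos) (auto simp: t_def divide_strict_right_mono)
      finally show ?thesis .
    qed
    from qform_coercive[OF this] show ?thesis by (simp add: qform_diff qform_congruence)
  qed
  then have "\<exists>c>0. \<forall>k\<in>{..<L}. \<forall>z. c * (norm z)\<^sup>2 \<le>
       qform (Sf (Suc k)) (prop_mat lam (rs ! k) *v z) - qform (Sf k) z"
    by (intro finite_uniform_small) (auto intro: order_trans[OF mult_right_mono])
  moreover have "(\<exists>e. e \<noteq> 0 \<and> 0 \<le> qform (Sf k) e) \<and> (\<exists>e. e \<noteq> 0 \<and> qform (Sf k) e \<le> 0)"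
    if k: "k \<le> L" for k
  proof
    have "0 \<le> qform (Sf k) (M k *v w)"
      using w t[OF k] unfolding q A_def by (simp add: qform_scaleR)
    then show "\<exists>e. e \<noteq> 0 \<and> 0 \<le> qform (Sf k) e" using M_nz w(1) by blast
    have "qform (Sf k) (M k *v x) = ((1 - t k) + t k * \<eta>\<^sup>2) * qform S x"
      using x unfolding q A_def by (simp add: qform_scaleR algebra_simps)
    also have "\<dots> \<le> 0" using x(3) t[OF k] by (intro mult_nonneg_nonpos add_nonneg_nonneg) auto
    finally show "\<exists>e. e \<noteq> 0 \<and> qform (Sf k) e \<le> 0" using M_nz x(1) by blast
  qed
  ultimately show ?thesis using S0 SL unfolding L_def by (metis lessThan_iff)
qed

lemma matrix_bilinear_bound:
  fixes S :: "real^2^2"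
  shows "\<exists>K. \<forall>z w. \<bar>z \<bullet> (S *v w)\<bar> \<le> K * (norm z * norm w)"
proof -
  obtain K where K: "\<And>w. norm (S *v w) \<le> norm w * K"
    using bounded_linear.bounded[OF matrix_vector_mul_bounded_linear[of S]] by blast
  have "\<bar>z \<bullet> (S *v w)\<bar> \<le> K * (norm z * norm w)" for z w
  proof -
    have "\<bar>z \<bullet> (S *v w)\<bar> \<le> norm z * norm (S *v w)" by (rule Cauchy_Schwarz_ineq2)
    also have "\<dots> \<le> norm z * (norm w * K)" using K by (intro mult_left_mono) auto
    finally show ?thesis by (simp add: mult_ac)
  qed
  then show ?thesis by blast
qed

lemma matrix_vector_bound:
  fixes S :: "real^2^2"
  shows "\<exists>K. \<forall>w. norm (S *v w) \<le> K * norm w"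
  using bounded_linear.bounded[OF matrix_vector_mul_bounded_linear[of S]] by (auto simp: mult.commute)

context resonator_chain
begin

text \<open>The forms of each block begin and end with the common \<open>S0\<close>, so they can be
  glued in any block order. Finitely many blocks and offsets make the constants uniform.\<close>

lemma chain_form_monotone:
  assumes tr: "\<forall>d\<in>{1..D}. \<bar>trace (block_prop lam (B d))\<bar> > 2"
    and ss: "source_sink {1..D} (\<lambda>d. block_prop lam (B d))"
  shows "\<exists>S K c. form_monotone (\<lambda>i. prop_mat lam (res_seq B chi i)) S K c"
proof -
  have D: "{1..D} \<noteq> {}" using valid unfolding valid_blocks_def by auto
  obtain S0 where S0: "\<forall>d\<in>{1..D}.
     (\<exists>w \<xi>. w \<noteq> 0 \<and> block_prop lam (B d) *v w = \<xi> *\<^sub>R w \<and> qform S0 w > 0) \<and>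
     (\<exists>w \<xi>. w \<noteq> 0 \<and> block_prop lam (B d) *v w = \<xi> *\<^sub>R w \<and> qform S0 w < 0) \<and>
     (\<forall>z. z \<noteq> 0 \<longrightarrow> qform S0 z < qform S0 (block_prop lam (B d) *v z))"
    using source_sink_form[OF _ D det_block_prop _ ss] tr by auto
  have "\<forall>d\<in>{1..D}. \<exists>Sf c. c > 0 \<and> Sf 0 = S0 \<and> Sf (length (B d)) = S0 \<and>
    (\<forall>k<length (B d). \<forall>z. c * (norm z)\<^sup>2 \<le>
       qform (Sf (Suc k)) (prop_mat lam (B d ! k) *v z) - qform (Sf k) z) \<and>
    (\<forall>k\<le>length (B d). (\<exists>e. e \<noteq> 0 \<and> 0 \<le> qform (Sf k) e) \<and> (\<exists>e. e \<noteq> 0 \<and> qform (Sf k) e \<le> 0))"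
  proof
    fix d assume d: "d \<in> {1..D}"
    have ne: "B d \<noteq> []" using block_nonempty[OF d] by auto
    obtain w \<xi> where w: "w \<noteq> 0" "block_prop lam (B d) *v w = \<xi> *\<^sub>R w" "qform S0 w > 0"
      using S0 d by blast
    obtain x \<eta> where x: "x \<noteq> 0" "block_prop lam (B d) *v x = \<eta> *\<^sub>R x" "qform S0 x < 0"
      using S0 d by blast
    show "\<exists>Sf c. c > 0 \<and> Sf 0 = S0 \<and> Sf (length (B d)) = S0 \<and>
      (\<forall>k<length (B d). \<forall>z. c * (norm z)\<^sup>2 \<le>
         qform (Sf (Suc k)) (prop_mat lam (B d ! k) *v z) - qform (Sf k) z) \<and>
      (\<forall>k\<le>length (B d). (\<exists>e. e \<noteq> 0 \<and> 0 \<le> qform (Sf k) e) \<and> (\<exists>e. e \<noteq> 0 \<and> qform (Sf k) e \<le> 0))"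
      by (rule block_forms[OF ne _ w x]) (use S0 d in blast)
  qed
  then obtain Sf c where
    c: "\<And>d. d \<in> {1..D} \<Longrightarrow> c d > 0" and
    Sf0: "\<And>d. d \<in> {1..D} \<Longrightarrow> Sf d 0 = S0 \<and> Sf d (length (B d)) = S0" and
    inc: "\<And>d k z. d \<in> {1..D} \<Longrightarrow> k < length (B d) \<Longrightarrow> c d * (norm z)\<^sup>2 \<le>
       qform (Sf d (Suc k)) (prop_mat lam (B d ! k) *v z) - qform (Sf d k) z" and
    dir: "\<And>d k. d \<in> {1..D} \<Longrightarrow> k \<le> length (B d) \<Longrightarrow>
       (\<exists>e. e \<noteq> 0 \<and> 0 \<le> qform (Sf d k) e) \<and> (\<exists>e. e \<noteq> 0 \<and> qform (Sf d k) e \<le> 0)"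
    by metis
  have "\<exists>c0>0. \<forall>d\<in>{1..D}. c0 \<le> c d"
    using c by (intro finite_uniform_small) auto
  then obtain c0 where c0: "c0 > 0" "\<And>d. d \<in> {1..D} \<Longrightarrow> c0 \<le> c d" by blast
  have "\<exists>K. \<forall>(d, k)\<in>Sigma {1..D} (\<lambda>d. {..length (B d)}).
      \<forall>z w. \<bar>z \<bullet> (Sf d k *v w)\<bar> \<le> K * (norm z * norm w)"
  proof (rule finite_uniform_large)
    fix p K and K' :: real
    assume "case p of (d, k) \<Rightarrow> \<forall>z w. \<bar>z \<bullet> (Sf d k *v w)\<bar> \<le> K * (norm z * norm w)" "K \<le> K'"
    then show "case p of (d, k) \<Rightarrow> \<forall>z w. \<bar>z \<bullet> (Sf d k *v w)\<bar> \<le> K' * (norm z * norm w)"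
      by (auto intro!: order_trans[OF _ mult_right_mono[of K K']])
  qed (use matrix_bilinear_bound in auto)
  then obtain K1 where K1: "\<And>d k z w. d \<in> {1..D} \<Longrightarrow> k \<le> length (B d) \<Longrightarrow>
      \<bar>z \<bullet> (Sf d k *v w)\<bar> \<le> K1 * (norm z * norm w)" by fastforce
  have "\<exists>K. \<forall>r\<in>resonators. \<forall>w. norm (prop_mat lam r *v w) \<le> K * norm w"
    using matrix_vector_bound
    by (intro finite_uniform_large) (auto intro: order_trans[OF _ mult_right_mono] finite_resonators)
  then obtain K2 where K2: "\<And>i w. norm (prop_mat lam (res_seq B chi i) *v w) \<le> K2 * norm w"
    using res_seq_in by blast
  have "\<forall>i. \<exists>j k. i = bs j + int k \<and> k < length (B (chi j))" using position by metis
  then obtain jj kk where jk: "\<And>i. i = bs (jj i) + int (kk i)" "\<And>i. kk i < length (B (chi (jj i)))"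
    by metis
  define S where "S i = Sf (chi (jj i)) (kk i)" for i
  define K where "K = max K1 K2"
  have "form_monotone (\<lambda>i. prop_mat lam (res_seq B chi i)) S K c0"
  proof
    show "c0 > 0" by fact
    fix i and z w :: "real^2"
    have d: "chi (jj i) \<in> {1..D}" using chi by blast
    have k: "kk i < length (B (chi (jj i)))" by (rule jk(2))
    show "norm (prop_mat lam (res_seq B chi i) *v z) \<le> K * norm z"
      using K2[of i z] mult_right_mono[of K2 K "norm z"] by (simp add: K_def)
    show "\<bar>z \<bullet> (S i *v w)\<bar> \<le> K * (norm z * norm w)"
      using K1[OF d less_imp_le[OF k], of z w] mult_right_mono[of K1 K "norm z * norm w"]
      by (simp add: K_def S_def)
    show "\<exists>e. e \<noteq> 0 \<and> 0 \<le> qform (S i) e" "\<exists>e. e \<noteq> 0 \<and> qform (S i) e \<le> 0"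
      using dir[OF d less_imp_le[OF k]] by (auto simp: S_def)
    have r: "res_seq B chi i = B (chi (jj i)) ! kk i"
      using res_seq_block[OF k] jk(1)[of i] by simp
    have "S (i + 1) = Sf (chi (jj i)) (Suc (kk i))"
    proof (cases "Suc (kk i) < length (B (chi (jj i)))")
      case True
      then have "jj (i + 1) = jj i" "kk (i + 1) = Suc (kk i)"
        using position_inj[of "jj (i + 1)" "kk (i + 1)" "jj i" "Suc (kk i)"] jk(1)[of i] jk(1)[of "i + 1"] jk(2)
        by auto
      then show ?thesis by (simp add: S_def)
    next
      case False
      \<comment> \<open>At the last site of a block the next site has offset 0 in the following
        block, where the form is again \<open>S0\<close>.\<close>
      then have l: "Suc (kk i) = length (B (chi (jj i)))" using k by simp
      then have "i + 1 = bs (jj i + 1)" using jk(1)[of i] by (simp add: block_start_succ)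
      then have "kk (i + 1) = 0"
        using position_inj(2)[of "jj (i + 1)" "kk (i + 1)" "jj i + 1" 0] jk(1)[of "i + 1"] jk(2)
          block_length_pos by auto
      then show ?thesis using Sf0 d chi unfolding S_def l by auto
    qed
    then show "c0 * (norm z)\<^sup>2 \<le> qform (S (i + 1)) (prop_mat lam (res_seq B chi i) *v z) - qform (S i) z"
      using inc[OF d k, of z] mult_right_mono[OF c0(2)[OF d], of "(norm z)\<^sup>2"]
      by (simp add: r S_def)
  qed
  then show ?thesis by blast
qed

end

section \<open>Hyperbolic blocks\<close>

lemma sq_add_le: "(a + b)\<^sup>2 \<le> 2 * (a\<^sup>2 + b\<^sup>2)" for a b :: real
  using sum_squares_bound[of a b] by (simp add: power2_sum)

lemma summable_on_of_bounded_sums: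
  fixes f :: "'a \<Rightarrow> real"
  assumes "\<And>i. f i \<ge> 0" "\<And>F. finite F \<Longrightarrow> sum f F \<le> E"
  shows "f summable_on UNIV"
  using assms by (intro nonneg_bdd_above_summable_on bdd_aboveI2[where M = E]) auto

lemma l2I:
  assumes "\<And>F. finite F \<Longrightarrow> (\<Sum>i\<in>F. (cmod (u i))\<^sup>2) \<le> E"
  shows "u \<in> l2" "(l2_norm u)\<^sup>2 \<le> E"
proof -
  show u: "u \<in> l2" unfolding l2_def using summable_on_of_bounded_sums[OF _ assms] by simp
  have "infsum (\<lambda>i. (cmod (u i))\<^sup>2) UNIV \<le> E"
    using u assms unfolding l2_def by (intro infsum_le_finite_sums) auto
  moreover have "infsum (\<lambda>i. (cmod (u i))\<^sup>2) UNIV \<ge> 0" by (intro infsum_nonneg) auto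
  ultimately show "(l2_norm u)\<^sup>2 \<le> E" by (simp add: l2_norm_def)
qed

lemma l2_sum_le:
  assumes "u \<in> l2" "finite F"
  shows "(\<Sum>i\<in>F. (cmod (u i))\<^sup>2) \<le> (l2_norm u)\<^sup>2"
proof -
  have "(\<Sum>i\<in>F. (cmod (u i))\<^sup>2) \<le> infsum (\<lambda>i. (cmod (u i))\<^sup>2) UNIV"
    using assms unfolding l2_def by (intro finite_sum_le_infsum) auto
  moreover have "infsum (\<lambda>i. (cmod (u i))\<^sup>2) UNIV \<ge> 0" by (intro infsum_nonneg) auto
  ultimately show ?thesis by (simp add: l2_norm_def)
qed

lemma l2_norm_nonneg: "l2_norm u \<ge> 0"
  by (simp add: l2_norm_def infsum_nonneg)

lemma l2_add:
  assumes "u \<in> l2" "v \<in> l2"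
  shows "(\<lambda>i. u i + v i) \<in> l2"
proof -
  have "(\<lambda>i. 2 * ((cmod (u i))\<^sup>2 + (cmod (v i))\<^sup>2)) summable_on UNIV"
    using assms unfolding l2_def by (intro summable_on_cmult_right summable_on_add) auto
  then have "(\<lambda>i. (cmod (u i + v i))\<^sup>2) summable_on UNIV"
  proof (rule summable_on_comparison_test)
    fix i
    have "(cmod (u i + v i))\<^sup>2 \<le> (cmod (u i) + cmod (v i))\<^sup>2"
      by (intro power_mono norm_triangle_ineq) auto
    then show "(cmod (u i + v i))\<^sup>2 \<le> 2 * ((cmod (u i))\<^sup>2 + (cmod (v i))\<^sup>2)"
      using sq_add_le order_trans by blast
  qed auto
  then show ?thesis by (simp add: l2_def)
qed

lemma l2_bounded_mult:
  assumes "u \<in> l2" "\<And>i. cmod (c i) \<le> M"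
  shows "(\<lambda>i. c i * u i) \<in> l2"
proof -
  have "(\<lambda>i. M\<^sup>2 * (cmod (u i))\<^sup>2) summable_on UNIV"
    using assms unfolding l2_def by (intro summable_on_cmult_right) auto
  then have "(\<lambda>i. (cmod (c i * u i))\<^sup>2) summable_on UNIV"
    by (rule summable_on_comparison_test)
      (use assms(2) in \<open>auto simp: norm_mult power_mult_distrib intro!: mult_right_mono power_mono\<close>)
  then show ?thesis by (simp add: l2_def)
qed

lemma summable_on_shift:
  fixes f :: "int \<Rightarrow> real"
  assumes "f summable_on UNIV"
  shows "(\<lambda>i. f (i + k)) summable_on UNIV"
  using assms summable_on_reindex_bij_betw[of "\<lambda>i. i + k" UNIV UNIV f] bij_plus_right[of k]
  by simp

lemma l2_shift:
  assumes "u \<in> l2"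
  shows "(\<lambda>i. u (i + k)) \<in> l2"
  using assms summable_on_shift[of "\<lambda>i. (cmod (u i))\<^sup>2" k] by (simp add: l2_def)

context resonator_chain
begin

section \<open>Real solutions and the bounded inverse\<close>

lemma coefficient_bounds:
  obtains M where "\<And>i. \<bar>jac_a B chi i\<bar> \<le> M" "\<And>i. \<bar>jac_b B chi i\<bar> \<le> M"
proof -
  obtain M where M: "M \<ge> 1" "\<And>i. 1 / sp i \<le> M" "\<And>i. \<rho> i \<le> M"
    using uniform_bound by metis
  have pos: "1 / sp i \<ge> 0" "\<rho> i \<ge> 0" for i using sp_pos[of i] \<rho>_pos[of i] by auto
  show thesis
  proof (rule that[of "M * M * (M + M)"])
    fix i
    have "\<bar>jac_a B chi i\<bar> = \<rho> i * \<rho> (i + 1) * (1 / sp i)"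
      using sp_pos[of i] \<rho>_pos[of i] \<rho>_pos[of "i + 1"] by (simp add: jac_a_eq abs_mult)
    also have "\<dots> \<le> M * M * M" using M pos by (intro mult_mono mult_nonneg_nonneg) auto
    also have "\<dots> \<le> M * M * (M + M)" using M by (intro mult_left_mono) auto
    finally show "\<bar>jac_a B chi i\<bar> \<le> M * M * (M + M)" .
    have "\<bar>jac_b B chi i\<bar> = \<rho> i * \<rho> i * (1 / sp (i - 1) + 1 / sp i)"
      using pos by (simp add: jac_b_eq abs_mult power2_eq_square)
    also have "\<dots> \<le> M * M * (M + M)"
      using M pos by (intro mult_mono mult_nonneg_nonneg add_mono add_nonneg_nonneg) auto
    finally show "\<bar>jac_b B chi i\<bar> \<le> M * M * (M + M)" .
  qed
qed

definition shifted :: "(int \<Rightarrow> complex) \<Rightarrow> int \<Rightarrow> complex" where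
  "shifted u i = jacobi B chi u i - of_real lam * u i"

lemma shifted_l2:
  assumes "u \<in> l2"
  shows "shifted u \<in> l2"
proof -
  obtain M where M: "\<And>i. \<bar>jac_a B chi i\<bar> \<le> M" "\<And>i. \<bar>jac_b B chi i\<bar> \<le> M"
    using coefficient_bounds by blast
  have "(\<lambda>i. of_real (jac_a B chi (i - 1)) * u (i - 1)) \<in> l2"
    using l2_bounded_mult[OF l2_shift[OF assms, of "- 1"], of "\<lambda>i. of_real (jac_a B chi (i - 1))" M] M
    by simp
  moreover have "(\<lambda>i. of_real (jac_a B chi i) * u (i + 1)) \<in> l2"
    using l2_bounded_mult[OF l2_shift[OF assms], of "\<lambda>i. of_real (jac_a B chi i)" M] M by simp
  moreover have "(\<lambda>i. of_real (jac_b B chi i) * u i) \<in> l2"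
    using l2_bounded_mult[OF assms, of "\<lambda>i. of_real (jac_b B chi i)" M] M by simp
  moreover have "(\<lambda>i. (- of_real lam) * u i) \<in> l2"
    using l2_bounded_mult[OF assms, of "\<lambda>i. - of_real lam" "\<bar>lam\<bar>"] by simp
  ultimately have "(\<lambda>i. of_real (jac_a B chi (i - 1)) * u (i - 1) + of_real (jac_a B chi i) * u (i + 1)
     + of_real (jac_b B chi i) * u i + (- of_real lam) * u i) \<in> l2"
    by (intro l2_add)
  then show ?thesis by (simp add: shifted_def[abs_def] jacobi_def)
qed

text \<open>The coefficients are real, so real and imaginary parts decouple and the real plane
  recursion can treat each of them.\<close>

definition real_shifted :: "(int \<Rightarrow> real) \<Rightarrow> int \<Rightarrow> real" where
  "real_shifted p i = jac_a B chi (i - 1) * p (i - 1) + jac_a B chi i * p (i + 1)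
     + jac_b B chi i * p i - lam * p i"

lemma Re_shifted: "Re (shifted u i) = real_shifted (\<lambda>i. Re (u i)) i"
  and Im_shifted: "Im (shifted u i) = real_shifted (\<lambda>i. Im (u i)) i"
  by (simp_all add: shifted_def jacobi_def real_shifted_def)

abbreviation "\<mu> i \<equiv> res_l (res_seq B chi i) / (res_v (res_seq B chi i))\<^sup>2 * lam"

lemma real_shifted_flux:
  "real_shifted p i = \<rho> i * ((\<rho> i * p i - \<rho> (i - 1) * p (i - 1)) / sp (i - 1)
     - (\<rho> (i + 1) * p (i + 1) - \<rho> i * p i) / sp i - \<mu> i * (\<rho> i * p i))"
  using jacobi_flux[of i p] by (simp add: real_shifted_def)

text \<open>The second entry is the flux across the gap to the left of site
  \<open>i\<close>.\<close>

definition state :: "(int \<Rightarrow> real) \<Rightarrow> int \<Rightarrow> real^2" where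
  "state p i = vector [\<rho> i * p i, (\<rho> i * p i - \<rho> (i - 1) * p (i - 1)) / sp (i - 1)]"

text \<open>A residual \<open>f i\<close> lowers the flux after site \<open>i\<close> by
  \<open>f i / \<rho> i\<close>, which changes the next position by \<open>sp i\<close> times as
  much.\<close>

definition forcing :: "(int \<Rightarrow> real) \<Rightarrow> int \<Rightarrow> real^2" where
  "forcing f i = vector [sp i * (f i / \<rho> i), f i / \<rho> i]"

lemma state_recursion:
  "state p (i + 1) = prop_mat lam (res_seq B chi i) *v state p i - forcing (real_shifted p) i"
proof -
  define x where "x i = \<rho> i * p i" for i
  define y where "y i = (x i - x (i - 1)) / sp (i - 1)" for i
  define g where "g = real_shifted p i / \<rho> i"
  have g: "g = y i - y (i + 1) - \<mu> i * x i"
    using \<rho>_pos[of i] by (simp add: g_def real_shifted_flux x_def y_def)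
  have x: "x (i + 1) = x i + sp i * y (i + 1)" using sp_pos[of i] by (simp add: y_def)
  have "x (i + 1) = (1 - sp i * \<mu> i) * x i + sp i * y i - sp i * g"
    unfolding x g by (simp add: algebra_simps)
  moreover have "y (i + 1) = - \<mu> i * x i + y i - g" unfolding g by simp
  ultimately show ?thesis
    unfolding vec_eq_iff forall_2 prop_mat_mult
    by (simp add: state_def forcing_def flip: x_def y_def g_def)
      (simp add: y_def x_def)
qed

text \<open>Converse of \<open>state_recursion\<close>: any orbit of the forced recursion is a
  state, because the recursion itself makes its second component the flux.\<close>

lemma recursion_solves:
  assumes rec: "\<And>i. z (i + 1) = prop_mat lam (res_seq B chi i) *v z i - forcing f i"
  shows "real_shifted (\<lambda>i. z i $ 1 / \<rho> i) i = f i"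
proof -
  define g where "g i = f i / \<rho> i" for i
  have z1: "z (i + 1) $ 1 = (1 - sp i * \<mu> i) * z i $ 1 + sp i * z i $ 2 - sp i * g i"
    and z2: "z (i + 1) $ 2 = - \<mu> i * z i $ 1 + z i $ 2 - g i" for i
    by (simp_all add: rec prop_mat_mult forcing_def g_def)
  \<comment> \<open>Eliminating the forcing between the two rows identifies the second component as
    the flux.\<close>
  have "z (i + 1) $ 1 - z i $ 1 = sp i * z (i + 1) $ 2" for i
    unfolding z1 z2 by (simp add: algebra_simps)
  then have y: "(z (i + 1) $ 1 - z i $ 1) / sp i = z (i + 1) $ 2" for i
    using sp_pos[of i] by simp
  have r: "\<rho> i * (z i $ 1 / \<rho> i) = z i $ 1" for i using \<rho>_pos[of i] by simp
  have "real_shifted (\<lambda>i. z i $ 1 / \<rho> i) i = \<rho> i * (z i $ 2 - z (i + 1) $ 2 - \<mu> i * z i $ 1)"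
    unfolding real_shifted_flux r using y[of i] y[of "i - 1"] by simp
  also have "\<dots> = \<rho> i * g i" unfolding z2 by simp
  finally show ?thesis using \<rho>_pos[of i] by (simp add: g_def)
qed

text \<open>The energy estimate gives the lower bound and the compactness argument gives solutions,
  with one constant for both.\<close>

lemma real_resolvent:
  assumes "form_monotone (\<lambda>i. prop_mat lam (res_seq B chi i)) S K c"
  obtains C where "C \<ge> 0"
    "\<And>p H F. (\<lambda>i. (p i)\<^sup>2) summable_on UNIV \<Longrightarrow>
       (\<And>F. finite F \<Longrightarrow> (\<Sum>i\<in>F. (real_shifted p i)\<^sup>2) \<le> H) \<Longrightarrow> finite F \<Longrightarrow> (\<Sum>i\<in>F. (p i)\<^sup>2) \<le> C * H"
    "\<And>f H. (\<And>F. finite F \<Longrightarrow> (\<Sum>i\<in>F. (f i)\<^sup>2) \<le> H) \<Longrightarrow>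
       \<exists>p. (\<forall>i. real_shifted p i = f i) \<and> (\<forall>F. finite F \<longrightarrow> (\<Sum>i\<in>F. (p i)\<^sup>2) \<le> C * H)"
proof -
  interpret form_monotone "\<lambda>i. prop_mat lam (res_seq B chi i)" S K c by fact
  obtain M where M: "M \<ge> 1" "\<And>i. sp i \<le> M" "\<And>i. 1 / sp i \<le> M" "\<And>i. \<rho> i \<le> M" "\<And>i. 1 / \<rho> i \<le> M"
    using uniform_bound by blast
  have sq: "(sp i)\<^sup>2 \<le> M\<^sup>2" "(1 / sp i)\<^sup>2 \<le> M\<^sup>2" "(\<rho> i)\<^sup>2 \<le> M\<^sup>2" "(1 / \<rho> i)\<^sup>2 \<le> M\<^sup>2" for i
    using M sp_pos[of i] \<rho>_pos[of i] by (auto intro!: power_mono simp del: power_divide)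
  define A where "A = (M\<^sup>2 + 1) * M\<^sup>2"
  have forcing_sum: "(\<Sum>i\<in>F. (norm (forcing f i))\<^sup>2) \<le> A * H"
    if "finite F" and H: "\<And>F. finite F \<Longrightarrow> (\<Sum>i\<in>F. (f i)\<^sup>2) \<le> H" for f H and F :: "int set"
  proof -
    have "(norm (forcing f i))\<^sup>2 \<le> A * (f i)\<^sup>2" for i
    proof -
      have "(norm (forcing f i))\<^sup>2 = (((sp i)\<^sup>2 + 1) * (1 / \<rho> i)\<^sup>2) * (f i)\<^sup>2"
        by (simp add: norm_2 forcing_def power_mult_distrib power_divide algebra_simps)
      also have "\<dots> \<le> A * (f i)\<^sup>2"
        unfolding A_def using sq[of i] by (intro mult_right_mono mult_mono) auto
      finally show ?thesis .
    qed
    then have "(\<Sum>i\<in>F. (norm (forcing f i))\<^sup>2) \<le> A * (\<Sum>i\<in>F. (f i)\<^sup>2)"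
      by (simp add: sum_distrib_left sum_mono)
    also have "\<dots> \<le> A * H" using H[OF that(1)] by (intro mult_left_mono) (auto simp: A_def)
    finally show ?thesis .
  qed
  have first: "(\<Sum>i\<in>F. (z i $ 1 / \<rho> i)\<^sup>2) \<le> M\<^sup>2 * E"
    if "(\<Sum>i\<in>F. (norm (z i))\<^sup>2) \<le> E" for z :: "int \<Rightarrow> real^2" and F E
  proof -
    have "(z i $ 1 / \<rho> i)\<^sup>2 \<le> M\<^sup>2 * (norm (z i))\<^sup>2" for i
    proof -
      have "(z i $ 1 / \<rho> i)\<^sup>2 = (1 / \<rho> i)\<^sup>2 * (z i $ 1)\<^sup>2" by (simp add: power_divide)
      also have "\<dots> \<le> M\<^sup>2 * (norm (z i))\<^sup>2" using sq[of i] by (intro mult_mono) (auto simp: norm_2)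
      finally show ?thesis .
    qed
    then have "(\<Sum>i\<in>F. (z i $ 1 / \<rho> i)\<^sup>2) \<le> M\<^sup>2 * (\<Sum>i\<in>F. (norm (z i))\<^sup>2)"
      by (simp add: sum_distrib_left sum_mono)
    also have "\<dots> \<le> M\<^sup>2 * E" using that by (intro mult_left_mono) auto
    finally show ?thesis .
  qed
  \<comment> \<open>The factors account for passing from \<open>z\<close> back to \<open>p\<close>,
    for the energy estimate, and for passing from \<open>f\<close> to the forcing.\<close>
  define C where "C = M\<^sup>2 * (2 * C\<^sub>1 / c * A)"
  show thesis
  proof (rule that[of C])
    show "C \<ge> 0" unfolding C_def A_def using C\<^sub>1_nonneg c by simp
  next
    fix p H and F :: "int set"
    assume p: "(\<lambda>i. (p i)\<^sup>2) summable_on UNIV" and F: "finite F"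
      and H: "\<And>F. finite F \<Longrightarrow> (\<Sum>i\<in>F. (real_shifted p i)\<^sup>2) \<le> H"
    \<comment> \<open>A summable majorant for the squared norms of the states, so that
      \<open>energy_bound\<close> applies.\<close>
    have "(\<lambda>i. M\<^sup>2 * (p i)\<^sup>2 + M\<^sup>2 * (2 * (M\<^sup>2 * (p i)\<^sup>2 + M\<^sup>2 * (p (i - 1))\<^sup>2))) summable_on UNIV"
      using p summable_on_shift[OF p, of "- 1"]
      by (intro summable_on_cmult_right summable_on_add) auto
    then have "(\<lambda>i. (norm (state p i))\<^sup>2) summable_on UNIV"
    proof (rule summable_on_comparison_test)
      fix i
      have r: "(\<rho> i * p i)\<^sup>2 \<le> M\<^sup>2 * (p i)\<^sup>2" for i
        using sq[of i] by (simp add: power_mult_distrib mult_right_mono)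
      have "((\<rho> i * p i - \<rho> (i - 1) * p (i - 1)) / sp (i - 1))\<^sup>2 =
          (1 / sp (i - 1))\<^sup>2 * (\<rho> i * p i + - (\<rho> (i - 1) * p (i - 1)))\<^sup>2"
        by (simp add: power_divide)
      also have "\<dots> \<le> M\<^sup>2 * (2 * ((\<rho> i * p i)\<^sup>2 + (- (\<rho> (i - 1) * p (i - 1)))\<^sup>2))"
        by (rule mult_mono[OF sq(2) sq_add_le]) auto
      also have "\<dots> \<le> M\<^sup>2 * (2 * (M\<^sup>2 * (p i)\<^sup>2 + M\<^sup>2 * (p (i - 1))\<^sup>2))"
        using r[of i] r[of "i - 1"] by (intro mult_left_mono add_mono) auto
      finally show "(norm (state p i))\<^sup>2 \<le>
          M\<^sup>2 * (p i)\<^sup>2 + M\<^sup>2 * (2 * (M\<^sup>2 * (p i)\<^sup>2 + M\<^sup>2 * (p (i - 1))\<^sup>2))"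
        using r[of i] by (simp only: norm_2 state_def vector_2)
    qed auto
    from energy_bound[OF state_recursion this forcing_sum F] H
    have "(\<Sum>i\<in>F. (norm (state p i))\<^sup>2) \<le> 2 * C\<^sub>1 / c * (A * H)" by blast
    from first[OF this] have "(\<Sum>i\<in>F. (state p i $ 1 / \<rho> i)\<^sup>2) \<le> M\<^sup>2 * (2 * C\<^sub>1 / c * (A * H))" .
    moreover have "state p i $ 1 / \<rho> i = p i" for i using \<rho>_pos[of i] by (simp add: state_def)
    ultimately show "(\<Sum>i\<in>F. (p i)\<^sup>2) \<le> C * H" by (simp add: C_def mult.assoc)
  next
    fix f :: "int \<Rightarrow> real" and H
    assume H: "\<And>F. finite F \<Longrightarrow> (\<Sum>i\<in>F. (f i)\<^sup>2) \<le> H"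
    obtain z where z: "\<And>i. z (i + 1) = prop_mat lam (res_seq B chi i) *v z i - forcing f i"
      "\<And>F. finite F \<Longrightarrow> (\<Sum>i\<in>F. (norm (z i))\<^sup>2) \<le> 2 * C\<^sub>1 / c * (A * H)"
      using solution_exists[of "forcing f" "A * H"] forcing_sum[OF _ H] by blast
    have "(\<Sum>i\<in>F. (z i $ 1 / \<rho> i)\<^sup>2) \<le> C * H" if "finite F" for F
      using first[OF z(2)[OF that]] by (simp add: C_def mult.assoc)
    then show "\<exists>p. (\<forall>i. real_shifted p i = f i) \<and> (\<forall>F. finite F \<longrightarrow> (\<Sum>i\<in>F. (p i)\<^sup>2) \<le> C * H)"
      using recursion_solves[OF z(1)] by (intro exI[of _ "\<lambda>i. z i $ 1 / \<rho> i"]) auto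
  qed
qed

lemma not_in_spectrum:
  assumes "form_monotone (\<lambda>i. prop_mat lam (res_seq B chi i)) S K c"
  shows "\<not> in_spectrum (jacobi B chi) (of_real lam)"
proof -
  obtain C where "C \<ge> 0"
    and low: "\<And>p H F. (\<lambda>i. (p i)\<^sup>2) summable_on UNIV \<Longrightarrow>
       (\<And>F. finite F \<Longrightarrow> (\<Sum>i\<in>F. (real_shifted p i)\<^sup>2) \<le> H) \<Longrightarrow> finite F \<Longrightarrow> (\<Sum>i\<in>F. (p i)\<^sup>2) \<le> C * H"
    and sol: "\<And>f H. (\<And>F. finite F \<Longrightarrow> (\<Sum>i\<in>F. (f i)\<^sup>2) \<le> H) \<Longrightarrow>
       \<exists>p. (\<forall>i. real_shifted p i = f i) \<and> (\<forall>F. finite F \<longrightarrow> (\<Sum>i\<in>F. (p i)\<^sup>2) \<le> C * H)"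
    using real_resolvent[OF assms] by blast
  have parts: "(\<Sum>i\<in>F. (Re (u i))\<^sup>2) \<le> (l2_norm u)\<^sup>2" "(\<Sum>i\<in>F. (Im (u i))\<^sup>2) \<le> (l2_norm u)\<^sup>2"
    if "u \<in> l2" "finite F" for u F
  proof -
    have "(\<Sum>i\<in>F. (Re (u i))\<^sup>2) \<le> (\<Sum>i\<in>F. (cmod (u i))\<^sup>2)" "(\<Sum>i\<in>F. (Im (u i))\<^sup>2) \<le> (\<Sum>i\<in>F. (cmod (u i))\<^sup>2)"
      by (auto intro!: sum_mono simp: cmod_power2)
    then show "(\<Sum>i\<in>F. (Re (u i))\<^sup>2) \<le> (l2_norm u)\<^sup>2" "(\<Sum>i\<in>F. (Im (u i))\<^sup>2) \<le> (l2_norm u)\<^sup>2"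
      using l2_sum_le[OF that] by auto
  qed
  have bound: "(l2_norm u)\<^sup>2 \<le> 2 * C * (l2_norm (shifted u))\<^sup>2" if u: "u \<in> l2" for u
  proof -
    let ?H = "(l2_norm (shifted u))\<^sup>2"
    have "(\<Sum>i\<in>F. (Re (u i))\<^sup>2) \<le> C * ?H" if "finite F" for F
      using parts(1)[OF u] parts(1)[OF shifted_l2[OF u]] that
      by (intro low summable_on_of_bounded_sums[where E = "(l2_norm u)\<^sup>2"]) (auto simp flip: Re_shifted)
    moreover have "(\<Sum>i\<in>F. (Im (u i))\<^sup>2) \<le> C * ?H" if "finite F" for F
      using parts(2)[OF u] parts(2)[OF shifted_l2[OF u]] that
      by (intro low summable_on_of_bounded_sums[where E = "(l2_norm u)\<^sup>2"]) (auto simp flip: Im_shifted)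
    ultimately have "(\<Sum>i\<in>F. (cmod (u i))\<^sup>2) \<le> 2 * C * ?H" if "finite F" for F
      using that by (fastforce simp: cmod_power2 sum.distrib)
    then show ?thesis by (rule l2I(2))
  qed
  have "bij_betw shifted l2 l2"
  proof (rule bij_betwI')
    fix u v assume u: "u \<in> l2" and v: "v \<in> l2"
    show "(shifted u = shifted v) = (u = v)"
    proof
      assume eq: "shifted u = shifted v"
      define w where "w i = u i + (- 1) * v i" for i
      have w: "w \<in> l2" unfolding w_def using u l2_bounded_mult[OF v, of "\<lambda>_. - 1" 1] by (intro l2_add) auto
      have "shifted w i = shifted u i - shifted v i" for i
        by (simp add: shifted_def jacobi_def w_def algebra_simps)
      then have "shifted w = (\<lambda>_. 0)" using eq by auto
      then have "(l2_norm w)\<^sup>2 \<le> 0" using bound[OF w] by (simp add: l2_norm_def)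
      then have "(cmod (w i))\<^sup>2 \<le> 0" for i using l2_sum_le[OF w, of "{i}"] by simp
      then show "u = v" by (auto simp: w_def fun_eq_iff)
    qed simp
  next
    fix f assume f: "f \<in> l2"
    let ?H = "(l2_norm f)\<^sup>2"
    obtain p where p: "\<And>i. real_shifted p i = Re (f i)" "\<And>F. finite F \<Longrightarrow> (\<Sum>i\<in>F. (p i)\<^sup>2) \<le> C * ?H"
      using sol[of "\<lambda>i. Re (f i)" ?H] parts(1)[OF f] by blast
    obtain q where q: "\<And>i. real_shifted q i = Im (f i)" "\<And>F. finite F \<Longrightarrow> (\<Sum>i\<in>F. (q i)\<^sup>2) \<le> C * ?H"
      using sol[of "\<lambda>i. Im (f i)" ?H] parts(2)[OF f] by blast
    define u where "u i = Complex (p i) (q i)" for i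
    have "(\<Sum>i\<in>F. (cmod (u i))\<^sup>2) \<le> C * ?H + C * ?H" if "finite F" for F
      using p(2)[OF that] q(2)[OF that] by (simp add: u_def cmod_power2 sum.distrib)
    then have "u \<in> l2" by (rule l2I(1))
    moreover have "f = shifted u"
      by (simp add: fun_eq_iff complex_eq_iff Re_shifted Im_shifted) (simp add: u_def p q)
    ultimately show "\<exists>u\<in>l2. f = shifted u" by blast
  qed (rule shifted_l2)
  moreover have "l2_norm u \<le> sqrt (2 * C) * l2_norm (shifted u)" if "u \<in> l2" for u
    using real_sqrt_le_mono[OF bound[OF that]] by (simp add: real_sqrt_mult l2_norm_nonneg)
  ultimately show ?thesis
    unfolding in_spectrum_def shifted_def[abs_def] by blast
qed

end

section \<open>Elliptic and parabolic blocks\<close>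

text \<open>Real matrices acting on complex pairs: the eigenvalues of an elliptic block are not
  real, while the matrices have a real type.\<close>

definition cact :: "real^2^2 \<Rightarrow> complex \<times> complex \<Rightarrow> complex \<times> complex" where
  "cact A z = (of_real (A$1$1) * fst z + of_real (A$1$2) * snd z,
    of_real (A$2$1) * fst z + of_real (A$2$2) * snd z)"

lemma cact_mul: "cact (A ** A') z = cact A (cact A' z)"
  by (simp add: cact_def matrix_matrix_mult_def sum_2 algebra_simps)

lemma cact_mat_1: "cact (mat 1) z = z"
  by (simp add: cact_def mat_def)

lemma cact_scale: "cact A (c * fst z, c * snd z) = (c * fst (cact A z), c * snd (cact A z))"
  by (simp add: cact_def algebra_simps)

lemma elliptic_eigenvector:
  fixes A :: "real^2^2"
  assumes det: "det A = 1" and tr: "\<bar>trace A\<bar> \<le> 2"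
  obtains \<xi> w where "cmod \<xi> = 1" "w \<noteq> (0, 0)" "cact A w = (\<xi> * fst w, \<xi> * snd w)"
proof -
  define h where "h = trace A / 2"
  have h: "h\<^sup>2 \<le> 1" using tr by (simp add: h_def abs_square_le_1)
  \<comment> \<open>The root of \<open>\<xi>^2 - 2 * h * \<xi> + 1\<close> in the closed upper half
    plane; \<open>\<bar>h\<bar> \<le> 1\<close> puts it on the unit circle.\<close>
  define \<xi> where "\<xi> = Complex h (sqrt (1 - h\<^sup>2))"
  have n: "cmod \<xi> = 1" using h by (simp add: \<xi>_def cmod_def)
  let ?a = "complex_of_real (A$1$1)" and ?b = "complex_of_real (A$1$2)"
    and ?c = "complex_of_real (A$2$1)" and ?d = "complex_of_real (A$2$2)"
  have "\<xi> + cnj \<xi> = of_real (trace A)" by (simp add: \<xi>_def h_def complex_eq_iff)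
  then have s: "cnj \<xi> = ?a + ?d - \<xi>" by (simp add: trace_def sum_2 algebra_simps)
  have "\<xi> * cnj \<xi> = of_real (det A)" using n det by (simp add: complex_norm_square[symmetric])
  then have ch: "\<xi> * (?a + ?d - \<xi>) = ?a * ?d - ?b * ?c" unfolding s by (simp add: det_2)
  \<comment> \<open>If the upper right entry is nonzero, the first row dictates an eigenvector.
    Otherwise the matrix is lower triangular and \<xi> is a diagonal entry.\<close>
  consider "?b \<noteq> 0" | "?b = 0" "\<xi> = ?d" | "?b = 0" "\<xi> \<noteq> ?d" by blast
  then show thesis
  proof cases
    case 1
    have "?c * ?b + ?d * (\<xi> - ?a) = \<xi> * (\<xi> - ?a)" using ch by (simp add: algebra_simps)
    then show thesis
      using that[OF n, of "(?b, \<xi> - ?a)"] 1 by (simp add: cact_def algebra_simps)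
  next
    case 2
    then show thesis using that[OF n, of "(0, 1)"] by (simp add: cact_def)
  next
    case 3
    have "(\<xi> - ?d) * (\<xi> - ?a) = 0" using ch 3 by (simp add: algebra_simps)
    then have "\<xi> = ?a" using 3 by simp
    then show thesis
      using that[OF n, of "(\<xi> - ?d, ?c)"] 3 by (simp add: cact_def algebra_simps)
  qed
qed

context resonator_chain
begin

lemma block_run:
  assumes "\<And>k. k < n \<Longrightarrow> chi (n0 + int k) = d" "m \<le> n"
  shows "bs (n0 + int m) = bs n0 + int (m * length (B d))"
  using assms(2)
proof (induction m)
  case (Suc m)
  have "bs (n0 + int (Suc m)) = bs (n0 + int m) + int (length (B (chi (n0 + int m))))"
    using block_start_succ[of B chi "n0 + int m"] by (simp add: add_ac)
  then show ?case using Suc assms(1)[of m] by (simp add: algebra_simps)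
qed simp

lemma res_seq_run:
  assumes run: "\<And>k. k < n \<Longrightarrow> chi (n0 + int k) = d" and t: "t < n * length (B d)"
  shows "res_seq B chi (bs n0 + int t) = B d ! (t mod length (B d))"
proof -
  define L where "L = length (B d)"
  have L: "L > 0" using t by (cases L) (auto simp: L_def)
  have m: "t div L < n" using t L by (simp add: L_def less_mult_imp_div_less)
  have "bs n0 + int t = bs (n0 + int (t div L)) + int (t mod L)"
    using block_run[OF run less_imp_le[OF m]] div_mult_mod_eq[of t L]
    unfolding L_def[symmetric] by (simp only: of_nat_add[symmetric] add.assoc)
  moreover have "chi (n0 + int (t div L)) = d" using run m by blast
  ultimately show ?thesis
    using res_seq_block[of "t mod L" "n0 + int (t div L)"] L by (simp add: L_def)
qed

lemma shifted_pointwise_bound: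
  obtains E where "\<And>u Z i. (\<And>i. cmod (u i) \<le> Z) \<Longrightarrow> cmod (shifted u i) \<le> E * Z"
proof -
  obtain M where M: "\<And>i. \<bar>jac_a B chi i\<bar> \<le> M" "\<And>i. \<bar>jac_b B chi i\<bar> \<le> M"
    using coefficient_bounds by blast
  have "0 \<le> M" using M(1)[of 0] by simp
  show thesis
  proof (rule that[of "M + M + M + \<bar>lam\<bar>"])
    fix u :: "int \<Rightarrow> complex" and Z i assume Z: "\<And>i. cmod (u i) \<le> Z"
    have "cmod (shifted u i) \<le> cmod (of_real (jac_a B chi (i - 1)) * u (i - 1))
        + cmod (of_real (jac_a B chi i) * u (i + 1)) + cmod (of_real (jac_b B chi i) * u i)
        + cmod (of_real lam * u i)"
      unfolding shifted_def jacobi_def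
      by (intro order_trans[OF norm_triangle_ineq4] add_mono norm_triangle_le norm_triangle_mono order_refl)
    also have "\<dots> \<le> M * Z + M * Z + M * Z + \<bar>lam\<bar> * Z"
      unfolding norm_mult norm_of_real using M Z \<open>0 \<le> M\<close> by (intro add_mono mult_mono) auto
    finally show "cmod (shifted u i) \<le> (M + M + M + \<bar>lam\<bar>) * Z" by (simp add: algebra_simps)
  qed
qed

text \<open>A bounded inverse would bound the norms of \<open>u\<close> by those of the residuals,
  but the former grow without limit while the latter stay bounded.\<close>

lemma in_spectrum_of_quasimodes:
  assumes "\<kappa> > 0"
    and "\<And>n::nat. \<exists>u\<in>l2. real n * \<kappa> \<le> (l2_norm u)\<^sup>2 \<and> (l2_norm (shifted u))\<^sup>2 \<le> R"
  shows "in_spectrum (jacobi B chi) (of_real lam)"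
proof (rule ccontr)
  assume "\<not> ?thesis"
  then obtain C where C: "\<And>u. u \<in> l2 \<Longrightarrow> l2_norm u \<le> C * l2_norm (shifted u)"
    unfolding in_spectrum_def shifted_def[abs_def] by blast
  obtain n :: nat where n: "C\<^sup>2 * R < real n * \<kappa>"
    using reals_Archimedean3[OF assms(1)] by blast
  obtain u where u: "u \<in> l2" "real n * \<kappa> \<le> (l2_norm u)\<^sup>2" "(l2_norm (shifted u))\<^sup>2 \<le> R"
    using assms(2) by blast
  have "(l2_norm u)\<^sup>2 \<le> (C * l2_norm (shifted u))\<^sup>2"
    using C[OF u(1)] l2_norm_nonneg by (intro power_mono) auto
  also have "\<dots> \<le> C\<^sup>2 * R" using u(3) by (simp add: power_mult_distrib mult_left_mono)
  finally show False using u(2) n by simp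
qed

end

text \<open>The orbit of \<open>w\<close> under the periodically repeated block: each completed copy
  contributes a factor \<xi>, and the remainder is propagated resonator by resonator.\<close>

definition bloch :: "real \<Rightarrow> resonator list \<Rightarrow> complex \<Rightarrow> complex \<times> complex \<Rightarrow> nat \<Rightarrow> complex \<times> complex" where
  "bloch lam rs \<xi> w t =
     (let z = cact (block_prop lam (take (t mod length rs) rs)) w; m = t div length rs
      in (\<xi> ^ m * fst z, \<xi> ^ m * snd z))"

lemma bloch_Suc:
  assumes ne: "rs \<noteq> []" and w: "cact (block_prop lam rs) w = (\<xi> * fst w, \<xi> * snd w)"
  shows "bloch lam rs \<xi> w (Suc t) = cact (prop_mat lam (rs ! (t mod length rs))) (bloch lam rs \<xi> w t)"
proof -
  define L where "L = length rs"
  define m k where "m = t div L" and "k = t mod L"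
  have L: "L > 0" and k: "k < L" using ne by (auto simp: L_def k_def)
  have step: "cact (prop_mat lam (rs ! k)) (bloch lam rs \<xi> w t) =
    (\<xi> ^ m * fst (cact (block_prop lam (take (Suc k) rs)) w),
     \<xi> ^ m * snd (cact (block_prop lam (take (Suc k) rs)) w))"
    using k unfolding bloch_def Let_def L_def[symmetric] m_def[symmetric] k_def[symmetric] cact_scale
    by (simp add: L_def take_Suc_conv_app_nth block_prop_snoc cact_mul)
  show ?thesis
  proof (cases "Suc k = L")
    \<comment> \<open>Only at the end of a copy does the eigenvector equation enter: it turns the
      full block product into one more power of \<xi>.\<close>
    case True
    then have "Suc t mod L = 0" "Suc t div L = Suc m"
      by (auto simp: k_def m_def mod_Suc div_Suc)
    then show ?thesis
      using step True w unfolding bloch_def[of _ _ _ _ "Suc t"] k_def[symmetric] L_def[symmetric]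
      by (simp add: block_prop_Nil cact_mat_1 L_def)
  next
    case False
    then have "Suc t mod L = Suc k" "Suc t div L = m"
      by (auto simp: k_def m_def mod_Suc div_Suc)
    then show ?thesis
      using step unfolding bloch_def[of _ _ _ _ "Suc t"] k_def[symmetric] L_def[symmetric] Let_def
      by simp
  qed
qed

text \<open>If the first component vanishes at the start, the second does not, and one propagation
  step feeds it into the first with factor the spacing.\<close>

lemma bloch_nonzero:
  assumes ne: "rs \<noteq> []" and s: "res_s (rs ! 0) > 0" and "w \<noteq> (0, 0)"
    and w: "cact (block_prop lam rs) w = (\<xi> * fst w, \<xi> * snd w)"
  obtains k where "k < length rs" "fst (bloch lam rs \<xi> w k) \<noteq> 0"
proof (cases "fst w = 0")
  case False
  then show thesis
    using that[of 0] ne by (simp add: bloch_def Let_def block_prop_Nil cact_mat_1)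
next
  case True
  then have w2: "snd w \<noteq> 0" using assms(3) by (cases w) auto
  have "bloch lam rs \<xi> w 0 = w" by (simp add: bloch_def Let_def block_prop_Nil cact_mat_1)
  then have "fst (bloch lam rs \<xi> w 1) \<noteq> 0"
    using bloch_Suc[OF ne w, of 0] True w2 s by (simp add: cact_def prop_mat_def Let_def)
  \<comment> \<open>For a block of length 1 that step would return a multiple of \<open>w\<close>,
    whose first component is 0.\<close>
  moreover have "1 < length rs"
  proof (rule ccontr)
    assume "\<not> 1 < length rs"
    then have "length rs = 1" using ne by (cases rs) auto
    then have "fst (bloch lam rs \<xi> w 1) = 0"
      using True by (simp add: bloch_def Let_def block_prop_Nil cact_mat_1)
    then show False using calculation by simp
  qed
  ultimately show thesis by (rule that[rotated])
qed

lemma cmod_bloch: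
  assumes "cmod \<xi> = 1"
  shows "cmod (fst (bloch lam rs \<xi> w t)) = cmod (fst (bloch lam rs \<xi> w (t mod length rs)))"
  using assms by (cases "rs = []") (simp_all add: bloch_def Let_def norm_mult norm_power)

context resonator_chain
begin

text \<open>A Bloch wave restricted to \<open>n\<close> consecutive copies of the block fails to be an eigenfunction
  only at the four sites next to the two cuts.\<close>

lemma truncated_bloch:
  fixes n0 :: int and n d :: nat
  defines "q \<equiv> bs n0 + int (n * length (B d))"
  assumes d: "d \<in> {1..D}" and run: "\<And>k. k < n \<Longrightarrow> chi (n0 + int k) = d"
    and w: "cact (block_prop lam (B d)) w = (\<xi> * fst w, \<xi> * snd w)"
    and u: "u = (\<lambda>i. if bs n0 \<le> i \<and> i < q
      then fst (bloch lam (B d) \<xi> w (nat (i - bs n0))) / of_real (\<rho> i) else 0)"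
    and i: "i \<notin> {bs n0 - 1, bs n0, q - 1, q}"
  shows "shifted u i = 0"
proof (cases "bs n0 < i \<and> i < q - 1")
  case False
  then have "i < bs n0 - 1 \<or> q < i" using i by auto
  then have "u (i - 1) = 0" "u i = 0" "u (i + 1) = 0" unfolding u by auto
  then show ?thesis by (simp add: shifted_def jacobi_def)
next
  case True
  define L where "L = length (B d)"
  \<comment> \<open>\<open>t\<close> is the offset of the left neighbour of \<open>i\<close>, so the
    three sites of the difference equation are at \<open>t\<close>, \<open>Suc t\<close> and
    \<open>Suc (Suc t)\<close>, all inside the run.\<close>
  define t where "t = nat (i - bs n0) - 1"
  have i_t: "i = bs n0 + int (Suc t)" using True by (simp add: t_def)
  have "int (Suc (Suc t)) < int (n * L)" using True unfolding q_def L_def[symmetric] i_t by linarith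
  then have t: "Suc (Suc t) < n * L" by (simp only: of_nat_less_iff)
  define X where "X k = fst (bloch lam (B d) \<xi> w k)" for k
  define Y where "Y k = snd (bloch lam (B d) \<xi> w k)" for k
  have ne: "B d \<noteq> []" using block_nonempty[OF d] by auto
  have x: "of_real (\<rho> (bs n0 + int k)) * u (bs n0 + int k) = X k" if "k < n * L" for k
    using that \<rho>_pos[of "bs n0 + int k"]
    by (simp add: u q_def L_def X_def del: of_nat_mult)
  have res: "res_seq B chi (bs n0 + int k) = B d ! (k mod length (B d))" if "k < n * L" for k
    by (rule res_seq_run) (use run that in \<open>auto simp: L_def\<close>)
  have Y: "Y (Suc k) = Y k - of_real (\<mu> (bs n0 + int k)) * X k"
    and X: "X (Suc k) = X k + of_real (sp (bs n0 + int k)) * Y (Suc k)" if "k < n * L" for k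
    using bloch_Suc[OF ne w, of k] unfolding res[OF that]
    by (simp_all add: X_def Y_def cact_def prop_mat_def Let_def algebra_simps)
  have dX: "(X (Suc k) - X k) / of_real (sp (bs n0 + int k)) = Y (Suc k)" if "k < n * L" for k
    using X[OF that] sp_pos[of "bs n0 + int k"] by simp
  have im: "i - 1 = bs n0 + int t" and ip: "i + 1 = bs n0 + int (Suc (Suc t))" using i_t by auto
  have "shifted u i = of_real (\<rho> i) * ((X (Suc t) - X t) / of_real (sp (bs n0 + int t))
      - (X (Suc (Suc t)) - X (Suc t)) / of_real (sp (bs n0 + int (Suc t)))
      - of_real (\<mu> (bs n0 + int (Suc t))) * X (Suc t))"
    using jacobi_flux[of i u] x[of t] x[of "Suc t"] x[of "Suc (Suc t)"] t
    unfolding shifted_def jacobi_def im ip unfolding i_t by simp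
  also have "\<dots> = of_real (\<rho> i) * (Y (Suc t) - Y (Suc (Suc t)) - of_real (\<mu> (bs n0 + int (Suc t))) * X (Suc t))"
    using dX[of t] dX[of "Suc t"] t by simp
  also have "\<dots> = 0" using Y[of "Suc t"] t by simp
  finally show ?thesis .
qed

lemma in_spectrum_elliptic:
  assumes pe: "pseudo_ergodic D chi" and d: "d \<in> {1..D}"
    and tr: "\<bar>trace (block_prop lam (B d))\<bar> \<le> 2"
  shows "in_spectrum (jacobi B chi) (of_real lam)"
proof -
  define L where "L = length (B d)"
  have ne: "B d \<noteq> []" and L: "L > 0" using block_nonempty[OF d] by (auto simp: L_def)
  have "B d ! 0 \<in> resonators"
    unfolding resonators_def using d nth_mem[of 0 "B d"] ne by blast
  then have "res_s (B d ! 0) > 0" by (rule resonators_pos(3))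
  obtain \<xi> w where \<xi>: "cmod \<xi> = 1" and w0: "w \<noteq> (0, 0)"
    and w: "cact (block_prop lam (B d)) w = (\<xi> * fst w, \<xi> * snd w)"
    using elliptic_eigenvector[OF det_block_prop tr] by blast
  define X where "X t = fst (bloch lam (B d) \<xi> w t)" for t
  have Xmod: "cmod (X t) = cmod (X (t mod L))" for t
    unfolding X_def L_def by (rule cmod_bloch[OF \<xi>])
  obtain k0 where k0: "k0 < L" "X k0 \<noteq> 0"
    using bloch_nonzero[OF ne \<open>res_s (B d ! 0) > 0\<close> w0 w] unfolding L_def X_def by blast
  define Z where "Z = Max ((\<lambda>k. cmod (X k)) ` {..<L})"
  have Z: "cmod (X t) \<le> Z" for t
    unfolding Xmod[of t] Z_def using L by (intro Max_ge) auto
  have "Z \<ge> 0" using Z[of 0] norm_ge_zero order_trans by blast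
  obtain M where M: "M \<ge> 1" "\<And>i. \<rho> i \<le> M" "\<And>i. 1 / \<rho> i \<le> M" using uniform_bound by metis
  obtain E where E: "\<And>u Z i. (\<And>i. cmod (u i) \<le> Z) \<Longrightarrow> cmod (shifted u i) \<le> E * Z"
    using shifted_pointwise_bound by blast
  define \<kappa> where "\<kappa> = (cmod (X k0) / M)\<^sup>2"
  \<comment> \<open>Four sites can carry a residual, each bounded by the uniform pointwise
    estimate.\<close>
  define R where "R = 4 * (E * (Z * M))\<^sup>2"
  have "\<exists>u\<in>l2. real n * \<kappa> \<le> (l2_norm u)\<^sup>2 \<and> (l2_norm (shifted u))\<^sup>2 \<le> R" for n :: nat
  proof -
    have "\<exists>n0. \<forall>k<n. chi (n0 + int k) = d"
    proof (cases "n = 0")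
      case False
      then show ?thesis
        \<comment> \<open>Pseudo-ergodicity is applied to the word of \<open>n\<close> copies of
          \<open>d\<close>; words are nonempty, hence the separate case of
          \<open>n = 0\<close>.\<close>
        using pe d unfolding pseudo_ergodic_def by (fastforce dest!: spec[of _ "replicate n d"])
    qed simp
    then obtain n0 where run: "\<And>k. k < n \<Longrightarrow> chi (n0 + int k) = d" by blast
    define p where "p = bs n0"
    define q where "q = p + int (n * L)"
    define u where "u = (\<lambda>i. if p \<le> i \<and> i < q then X (nat (i - p)) / of_real (\<rho> i) else 0)"
    have zero: "shifted u i = 0" if "i \<notin> {p - 1, p, q - 1, q}" for i
      using that
      by (intro truncated_bloch[OF d run w]) (auto simp: u_def p_def q_def L_def X_def)
    have ub: "cmod (u i) \<le> Z * M" for i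
    proof (cases "p \<le> i \<and> i < q")
      case True
      then have "cmod (u i) = cmod (X (nat (i - p))) * (1 / \<rho> i)"
        using \<rho>_pos[of i] by (simp add: u_def norm_divide)
      also have "\<dots> \<le> Z * M" using Z M \<rho>_pos[of i] \<open>Z \<ge> 0\<close> by (intro mult_mono) auto
      finally show ?thesis .
    next
      case False
      then have "u i = 0" unfolding u_def by auto
      then show ?thesis using \<open>Z \<ge> 0\<close> M by simp
    qed
    have "(\<Sum>i\<in>F. (cmod (u i))\<^sup>2) \<le> (\<Sum>i\<in>{p..<q}. (cmod (u i))\<^sup>2)" if "finite F" for F
    proof -
      have "(\<Sum>i\<in>F. (cmod (u i))\<^sup>2) = (\<Sum>i\<in>F \<inter> {p..<q}. (cmod (u i))\<^sup>2)"
        using that by (intro sum.mono_neutral_right) (auto simp: u_def)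
      also have "\<dots> \<le> (\<Sum>i\<in>{p..<q}. (cmod (u i))\<^sup>2)" by (intro sum_mono2) auto
      finally show ?thesis .
    qed
    then have ul2: "u \<in> l2" by (rule l2I(1))
    have "real n * \<kappa> \<le> (l2_norm u)\<^sup>2"
    proof -
      \<comment> \<open>One site per copy of the block, at the offset where the Bloch wave is
        nonzero. Its modulus repeats from copy to copy, so the squared norm grows linearly in
        \<open>n\<close>.\<close>
      define g where "g m = p + int (m * L + k0)" for m
      have inj: "inj_on g {..<n}" using L by (auto simp: g_def inj_on_def)
      have val: "\<kappa> \<le> (cmod (u (g m)))\<^sup>2" if "m < n" for m
      proof -
        have "m * L + k0 < Suc m * L" using k0 by simp
        also have "\<dots> \<le> n * L" using that by (intro mult_le_mono1) simp
        finally have "u (g m) = X (m * L + k0) / of_real (\<rho> (g m))"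
          by (simp add: u_def g_def q_def flip: of_nat_add of_nat_mult)
        then have "cmod (u (g m)) = cmod (X k0) / \<rho> (g m)"
          using Xmod[of "m * L + k0"] k0 \<rho>_pos[of "g m"] by (simp add: norm_divide)
        also have "\<dots> \<ge> cmod (X k0) / M" using M \<rho>_pos by (intro divide_left_mono) auto
        finally show ?thesis unfolding \<kappa>_def using M by (intro power_mono) auto
      qed
      have "real n * \<kappa> = (\<Sum>m<n. \<kappa>)" by simp
      also have "\<dots> \<le> (\<Sum>m<n. (cmod (u (g m)))\<^sup>2)" using val by (intro sum_mono) auto
      also have "\<dots> = (\<Sum>i\<in>g ` {..<n}. (cmod (u i))\<^sup>2)" using inj by (simp add: sum.reindex)
      also have "\<dots> \<le> (l2_norm u)\<^sup>2" using ul2 by (intro l2_sum_le) auto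
      finally show ?thesis .
    qed
    moreover have "(l2_norm (shifted u))\<^sup>2 \<le> R"
    proof (rule l2I(2))
      fix F :: "int set" assume "finite F"
      let ?W = "{p - 1, p, q - 1, q}"
      have "(\<Sum>i\<in>F. (cmod (shifted u i))\<^sup>2) = (\<Sum>i\<in>F \<inter> ?W. (cmod (shifted u i))\<^sup>2)"
        using \<open>finite F\<close> zero by (intro sum.mono_neutral_right) auto
      also have "\<dots> \<le> (\<Sum>i\<in>F \<inter> ?W. (E * (Z * M))\<^sup>2)"
        using E[OF ub] by (intro sum_mono power_mono) auto
      also have "\<dots> = real (card (F \<inter> ?W)) * (E * (Z * M))\<^sup>2" by simp
      also have "\<dots> \<le> 4 * (E * (Z * M))\<^sup>2"
      proof (intro mult_right_mono)
        have "card (F \<inter> ?W) \<le> card ?W" by (intro card_mono) auto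
        also have "\<dots> \<le> 4" by (simp add: card_insert_if)
        finally show "real (card (F \<inter> ?W)) \<le> 4" by simp
      qed simp
      finally show "(\<Sum>i\<in>F. (cmod (shifted u i))\<^sup>2) \<le> R" by (simp add: R_def)
    qed
    ultimately show ?thesis using ul2 by blast
  qed
  moreover have "\<kappa> > 0" using k0 M by (simp add: \<kappa>_def)
  ultimately show ?thesis by (rule in_spectrum_of_quasimodes[rotated])
qed

end

theorem theorem3p20:
  fixes D :: nat and B :: "nat \<Rightarrow> resonator list" and chi :: "int \<Rightarrow> nat" and lam :: real
  assumes "valid_blocks D B"
    and "\<forall>j. chi j \<in> {1..D}"
    and "pseudo_ergodic D chi"
    and "lam \<ge> 0"
  shows "((\<forall>d\<in>{1..D}. \<bar>trace (block_prop lam (B d))\<bar> > 2) \<and>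
           source_sink {1..D} (\<lambda>d. block_prop lam (B d))
          \<longrightarrow> \<not> in_spectrum (jacobi B chi) (of_real lam))
       \<and> ((\<exists>d\<in>{1..D}. \<bar>trace (block_prop lam (B d))\<bar> \<le> 2)
          \<longrightarrow> in_spectrum (jacobi B chi) (of_real lam))"
proof -
  interpret resonator_chain D B chi lam using assms(1,2) by unfold_locales
  show ?thesis
    using chain_form_monotone not_in_spectrum in_spectrum_elliptic[OF assms(3)] by blast
qed

end
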